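(* Let $G$ be a compact group acting isometrically on a Banach space $E=\overline{\bigoplus_{j\in\mathbb N}E_j}$, where the subspaces $E_j$ are $G$-invariant and there is a finite-dimensional space $V$, on which $G$ acts admissibly, such that $E_j\simeq V$ for every $j\in\mathbb N$. Set $Y_k=\bigoplus_{j=0}^kE_j$ and $Z_k=\overline{\bigoplus_{j=k}^\infty E_j}$. Let $f:E\to\mathbb R$ be a continuous and $G$-invariant functional. Suppose that for every $k\in\mathbb N$ there exist $\rho_k>r_k>0$ such that ($A_2$) $a_k:=\max\{f(u):u\in Y_k,\ \|u\|=\rho_k\}\le0$; ($A_3$) $b_k:=\inf\{f(u):u\in Z_k,\ \|u\|=r_k\}\to\infty$ as $k\to\infty$; and suppose that ($A_4$) $f$ satisfies the $G$-$(PS)_c$ condition for every $c>0$. Then $f$ has an unbounded sequence of $G$-critical values.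
   Context: The action of $G$ on $E$ is by linear isometries (continuous action), and $E_j\simeq V$ means isomorphic as spaces with $G$-action. A set $A\subset E$ is $G$-invariant if $g(A)=A$ for all $g\in G$; a function $h:E\to\mathbb R$ is $G$-invariant if $h\circ g=h$ for all $g\in G$; a map $h$ is $G$-equivariant if $h\circ g=g\circ h$ for all $g\in G$. Admissible action: let $G$ be a compact group acting on a finite-dimensional space $V$ and diagonally on $V^k$, i.e. $g(v_1,\dots,v_k)=(gv_1,\dots,gv_k)$. The action of $G$ on $V$ is admissible if, for every $k\ge2$ and every open bounded $G$-invariant neighborhood $U$ of $0$ in $V^k$, every continuous $G$-equivariant map $\partial U\to V^{k-1}$ has a zero. Equivariant weak slope: $E$ carries the metric $d(u,v)=\|u-v\|$. For a continuous $G$-invariant $f:E\to\mathbb R$ and $u\in E$, $|d_Gf|(u)\in[0,\infty]$ is the supremum of the $\sigma\in[0,\infty)$ for which there exist a $G$-invariant neighborhood $U$ of $u$, a number $\delta>0$ and a continuous map $\mathcal H:U\times[0,\delta]\to E$ such that for all $v\in U$ and $t\in[0,\delta]$: $\mathcal H(\cdot,t)$ is $G$-equivariant, $d(\mathcal H(v,t),v)\le t$, and $f(\mathcal H(v,t))\le f(v)-\sigma t$. A real number $c$ is a $G$-critical value of $f$ if there is $u\in E$ with $|d_Gf|(u)=0$ and $f(u)=c$. The functional $f$ satisfies the $G$-$(PS)_c$ condition if every sequence $(u_h)$ in $E$ with $|d_Gf|(u_h)\to0$ and $f(u_h)\to c$ has a subsequence converging in $E$. *)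

theory Defs
  imports "HOL-Analysis.Analysis"
begin

text \<open>
  Groups are written additively, since \<open>topological_group_add\<close> is the library's class of
  topological groups; it extends \<open>group_add\<close>, so commutativity is not assumed.
\<close>

definition linear_action :: "('g::topological_group_add \<Rightarrow> 'a::real_normed_vector \<Rightarrow> 'a) \<Rightarrow> bool" where
  "linear_action act \<longleftrightarrow>
     (\<forall>g. linear (act g)) \<and>
     (\<forall>x. act 0 x = x) \<and>
     (\<forall>g h x. act (g + h) x = act g (act h x)) \<and>
     continuous_on UNIV (\<lambda>(g, x). act g x)"

definition isometric_action :: "('g::topological_group_add \<Rightarrow> 'a::real_normed_vector \<Rightarrow> 'a) \<Rightarrow> bool" where
  "isometric_action act \<longleftrightarrow> linear_action act \<and> (\<forall>g x. norm (act g x) = norm x)"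

definition invariant_set :: "('g \<Rightarrow> 'a \<Rightarrow> 'a) \<Rightarrow> 'a set \<Rightarrow> bool" where
  "invariant_set act A \<longleftrightarrow> (\<forall>g. act g ` A = A)"

definition invariant_fun :: "('g \<Rightarrow> 'a \<Rightarrow> 'a) \<Rightarrow> ('a \<Rightarrow> 'b) \<Rightarrow> bool" where
  "invariant_fun act f \<longleftrightarrow> (\<forall>g. f \<circ> act g = f)"

definition equivariant_on ::
  "'a set \<Rightarrow> ('g \<Rightarrow> 'a \<Rightarrow> 'a) \<Rightarrow> ('g \<Rightarrow> 'b \<Rightarrow> 'b) \<Rightarrow> ('a \<Rightarrow> 'b) \<Rightarrow> bool" where
  "equivariant_on A act act' h \<longleftrightarrow> (\<forall>g. \<forall>x\<in>A. h (act g x) = act' g (h x))"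

text \<open>
  The power \<open>V^k\<close> has to be available for all \<open>k\<close> at once, so its elements are the
  functions on \<open>{..<k}\<close> that are \<open>undefined\<close> elsewhere (the carrier of \<open>product_topology\<close>).
\<close>

definition power_top :: "nat \<Rightarrow> (nat \<Rightarrow> 'v::topological_space) topology" where
  "power_top k = product_topology (\<lambda>_. euclidean) {..<k}"

definition diag_action :: "nat \<Rightarrow> ('g \<Rightarrow> 'v \<Rightarrow> 'v) \<Rightarrow> 'g \<Rightarrow> (nat \<Rightarrow> 'v) \<Rightarrow> (nat \<Rightarrow> 'v)" where
  "diag_action k act g x = (\<lambda>i\<in>{..<k}. act g (x i))"

definition power_zero :: "nat \<Rightarrow> nat \<Rightarrow> 'v::zero" where
  "power_zero k = (\<lambda>i\<in>{..<k}. 0)"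

definition admissible :: "('g::topological_group_add \<Rightarrow> 'v::euclidean_space \<Rightarrow> 'v) \<Rightarrow> bool" where
  "admissible act \<longleftrightarrow>
     (\<forall>k\<ge>2. \<forall>U. openin (power_top k) U \<and> power_zero k \<in> U \<and>
        (\<exists>B. \<forall>x\<in>U. \<forall>i<k. norm (x i) \<le> B) \<and>
        invariant_set (diag_action k act) U \<longrightarrow>
        (\<forall>h. continuous_map (subtopology (power_top k) (power_top k frontier_of U)) (power_top (k - 1)) h \<and>
             equivariant_on (power_top k frontier_of U) (diag_action k act) (diag_action (k - 1) act) h \<longrightarrow>
             (\<exists>x \<in> power_top k frontier_of U. h x = power_zero (k - 1))))"

definition action_iso ::
  "('g \<Rightarrow> 'v::real_normed_vector \<Rightarrow> 'v) \<Rightarrow> ('g \<Rightarrow> 'e::real_normed_vector \<Rightarrow> 'e) \<Rightarrow> 'e set \<Rightarrow> bool" where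
  "action_iso actV actE F \<longleftrightarrow>
     (\<exists>\<phi> \<psi>. linear \<phi> \<and> homeomorphism UNIV F \<phi> \<psi> \<and> equivariant_on UNIV actV actE \<phi>)"

text \<open>
  Algebraic directness of the sum only; no closed complements or bounded projections are required.
\<close>

definition direct_family :: "(nat \<Rightarrow> 'e::real_vector set) \<Rightarrow> bool" where
  "direct_family F \<longleftrightarrow>
     (\<forall>n v. (\<forall>j\<le>n. v j \<in> F j) \<and> (\<Sum>j\<le>n. v j) = 0 \<longrightarrow> (\<forall>j\<le>n. v j = 0))"

definition Y_space :: "(nat \<Rightarrow> 'e::real_vector set) \<Rightarrow> nat \<Rightarrow> 'e set" where
  "Y_space F k = span (\<Union>j\<in>{0..k}. F j)"

definition Z_space :: "(nat \<Rightarrow> 'e::real_normed_vector set) \<Rightarrow> nat \<Rightarrow> 'e set" where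
  "Z_space F k = closure (span (\<Union>j\<in>{k..}. F j))"

definition weak_slope ::
  "('g \<Rightarrow> 'e::real_normed_vector \<Rightarrow> 'e) \<Rightarrow> ('e \<Rightarrow> real) \<Rightarrow> 'e \<Rightarrow> ennreal" where
  "weak_slope act f u = Sup {ennreal \<sigma> | \<sigma>. 0 \<le> \<sigma> \<and>
     (\<exists>U \<delta> H. invariant_set act U \<and> u \<in> interior U \<and> 0 < \<delta> \<and>
        continuous_on (U \<times> {0..\<delta>}) (\<lambda>(v, t). H v t) \<and>
        (\<forall>t\<in>{0..\<delta>}. equivariant_on U act act (\<lambda>v. H v t)) \<and>
        (\<forall>v\<in>U. \<forall>t\<in>{0..\<delta>}. dist (H v t) v \<le> t \<and> f (H v t) \<le> f v - \<sigma> * t))}"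

definition critical_value ::
  "('g \<Rightarrow> 'e::real_normed_vector \<Rightarrow> 'e) \<Rightarrow> ('e \<Rightarrow> real) \<Rightarrow> real \<Rightarrow> bool" where
  "critical_value act f c \<longleftrightarrow> (\<exists>u. weak_slope act f u = 0 \<and> f u = c)"

definition PS_condition ::
  "('g \<Rightarrow> 'e::real_normed_vector \<Rightarrow> 'e) \<Rightarrow> ('e \<Rightarrow> real) \<Rightarrow> real \<Rightarrow> bool" where
  "PS_condition act f c \<longleftrightarrow>
     (\<forall>u :: nat \<Rightarrow> 'e. (\<lambda>h. weak_slope act f (u h)) \<longlonglongrightarrow> 0 \<and> (\<lambda>h. f (u h)) \<longlonglongrightarrow> c \<longrightarrow>
        (\<exists>l s. strict_mono (s :: nat \<Rightarrow> nat) \<and> (u \<circ> s) \<longlonglongrightarrow> l))"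

end

theory Submission
  imports Defs
begin

text \<open>
  The critical values are minimax values over the equivariant maps \<open>\<gamma>\<close> on the ball of radius
  \<open>\<rho> k\<close> in \<open>Y_space E k\<close> that fix the bounding sphere and the origin.

  Linking. An admissible action turns the dimension gap between \<open>V\<^bsup>k+1\<^esup>\<close> and \<open>V\<^bsup>k\<^esup>\<close> into zeros of
  equivariant maps. If \<open>T\<close> is an equivariant map from \<open>E\<close> to \<open>V\<^bsup>k\<^esup>\<close> whose zeros lie in \<open>Z_space E k\<close>,
  then \<open>T \<circ> \<gamma>\<close> must vanish somewhere on the frontier of the set of points of the ball that \<open>\<gamma>\<close> sends
  into the open ball of radius \<open>r k\<close>, and there \<open>\<gamma>\<close> takes a value of norm \<open>r k\<close> in \<open>Z_space E k\<close>
  (\<open>admissible_linking\<close>). So the minimax value is at least the infimum in (A3), which tends to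
  infinity. The usual choice of \<open>T\<close>, the projection along \<open>Z_space E k\<close>, need not exist here, because
  \<open>Z_space E k\<close> may meet the first blocks. A Tikhonov regularised
  approximation replaces it: \<open>T y\<close> is the coefficient vector that minimises the distance from \<open>y\<close>
  minus the block sum to \<open>Z_space E k\<close>, plus an invariant strongly convex energy
  (\<open>equivariant_map_zeros_in_closed_subspace\<close>). Uniqueness of the minimiser gives equivariance,
  strong convexity gives continuity, and a small step in a good direction beats the zero vector
  unless \<open>y\<close> lies in \<open>Z_space E k\<close>.

  Criticality. No deformation of sublevel sets is constructed. The ordering principle of Brezis and
  Browder (equivalently, Ekeland's principle on the space of maps) gives a nearly
  optimal \<open>\<gamma>\<close> whose maximum cannot be lowered at rate \<open>\<sigma>\<close> per unit of uniform displacement. If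
  the weak slope exceeded \<open>\<sigma>\<close> at every point of the image where the maximum is attained, then the
  local deformations witnessing this, finitely many by compactness, could be glued into one that
  lowers the maximum at rate \<open>\<sigma>\<close> (\<open>equivariant_push_down\<close>). Hence there are points of small
  slope near the minimax level (\<open>minimax_almost_critical\<close>), and the Palais-Smale condition with the
  lower semicontinuity of the weak slope yields a critical point.

  The competing maps are required to fix the origin because the open set to which admissibility is
  applied has to contain \<open>0\<close>. Deformations respect this as soon as the minimax level exceeds \<open>f 0\<close>, which holds for large \<open>k\<close>.
\<close>

section \<open>Isometric actions\<close>

lemma isometric_action_linear: "isometric_action act \<Longrightarrow> linear (act g)"
  by (auto simp: isometric_action_def linear_action_def)

lemma linear_action_cancel:
  assumes "linear_action act"
  shows "act (- g) (act g x) = x" "act g (act (- g) x) = x"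
  using assms unfolding linear_action_def
  by (metis left_minus, metis right_minus)

lemma isometric_action_cancel:
  assumes "isometric_action act"
  shows "act (- g) (act g x) = x" "act g (act (- g) x) = x"
  using assms linear_action_cancel[of act g x] by (auto simp: isometric_action_def)

lemma isometric_action_dist:
  assumes "isometric_action act"
  shows "dist (act g x) (act g y) = dist x y"
proof -
  have "act g x - act g y = act g (x - y)"
    using isometric_action_linear[OF assms] by (simp add: linear_diff)
  then show ?thesis
    using assms by (simp add: dist_norm isometric_action_def)
qed

lemma isometric_action_continuous:
  assumes "isometric_action act"
  shows "continuous_on S (act g)"
  by (rule lipschitz_on_continuous_on[of 1])
     (auto intro: lipschitz_onI simp: isometric_action_dist[OF assms])

lemma invariant_setI:
  assumes "linear_action act" and "\<And>g x. x \<in> A \<Longrightarrow> act g x \<in> A"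
  shows "invariant_set act A"
  unfolding invariant_set_def
proof (intro allI equalityI subsetI)
  fix g x assume "x \<in> A"
  then have "act (- g) x \<in> A" "act g (act (- g) x) = x"
    using assms linear_action_cancel by auto
  then show "x \<in> act g ` A" by (metis imageI)
qed (use assms in auto)

lemma invariant_set_iff:
  assumes "linear_action act" and "invariant_set act A"
  shows "act g x \<in> A \<longleftrightarrow> x \<in> A"
proof
  assume "act g x \<in> A"
  then have "act (- g) (act g x) \<in> A"
    using assms(2) by (auto simp: invariant_set_def)
  then show "x \<in> A" using linear_action_cancel[OF assms(1)] by simp
qed (use assms in \<open>auto simp: invariant_set_def\<close>)

lemma isometric_imp_linear_action: "isometric_action act \<Longrightarrow> linear_action act"
  by (simp add: isometric_action_def)

lemma invariant_set_Compl:
  assumes "linear_action act" and "invariant_set act A"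
  shows "invariant_set act (- A)"
  using invariant_set_iff[OF assms] by (intro invariant_setI[OF assms(1)]) auto

lemma invariant_set_interior:
  assumes iso: "isometric_action act" and inv: "invariant_set act A"
  shows "invariant_set act (interior A)"
proof (rule invariant_setI[OF isometric_imp_linear_action[OF iso]])
  fix g x assume "x \<in> interior A"
  then obtain e where e: "e > 0" "ball x e \<subseteq> A" by (auto simp: mem_interior)
  have "ball (act g x) e \<subseteq> A"
  proof
    fix y assume "y \<in> ball (act g x) e"
    then have "dist (act g x) (act g (act (- g) y)) < e"
      by (simp add: isometric_action_cancel[OF iso])
    then have "act (- g) y \<in> A"
      using e by (auto simp: isometric_action_dist[OF iso])
    then show "y \<in> A"
      using invariant_set_iff[OF isometric_imp_linear_action[OF iso] inv] by blast
  qed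
  then show "act g x \<in> interior A" using e by (auto simp: mem_interior)
qed

lemma infdist_invariant:
  assumes iso: "isometric_action act" and inv: "invariant_set act A"
  shows "infdist (act g x) A = infdist x A"
proof (cases "A = {}")
  case False
  have "(\<lambda>a. dist (act g x) a) ` A = (\<lambda>a. dist (act g x) a) ` (act g ` A)"
    using inv by (simp add: invariant_set_def)
  also have "\<dots> = dist x ` A"
    by (simp add: image_image isometric_action_dist[OF iso])
  finally show ?thesis using False by (simp add: infdist_def)
qed (simp add: infdist_def)

lemma one_sided_lipschitz_continuous:
  fixes w :: "'a::metric_space \<Rightarrow> real"
  assumes "\<And>y z. w y - dist y z \<le> w z"
  shows "continuous_on S w"
proof (rule lipschitz_on_continuous_on[of 1], rule lipschitz_onI)
  fix x y
  show "dist (w x) (w y) \<le> 1 * dist x y"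
    using assms[of x y] assms[of y x] by (simp add: dist_real_def dist_commute abs_le_iff)
qed simp

section \<open>Deformations with a time budget\<close>

text \<open>
  A state \<open>(y, \<tau>)\<close> consists of a position and of unspent time. Displacement is bounded by the time
  spent, and \<open>f\<close> falls at rate \<open>\<sigma>\<close> in the time spent. Since the unspent time is part of the state,
  running one flow after another keeps the ratio \<open>\<sigma>\<close> between loss of height and displacement;
  adding up separate displacements of several local deformations would lose a factor.
\<close>

definition budget_flow ::
  "('g \<Rightarrow> 'e::real_normed_vector \<Rightarrow> 'e) \<Rightarrow> ('e \<Rightarrow> real) \<Rightarrow> real \<Rightarrow> ('e \<times> real \<Rightarrow> 'e \<times> real) \<Rightarrow> bool" where
  "budget_flow act f \<sigma> D \<longleftrightarrow>
     continuous_on (UNIV \<times> {0..}) D \<and>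
     (\<forall>g y \<tau>. 0 \<le> \<tau> \<longrightarrow> D (act g y, \<tau>) = (act g (fst (D (y, \<tau>))), snd (D (y, \<tau>)))) \<and>
     (\<forall>y \<tau>. 0 \<le> \<tau> \<longrightarrow> 0 \<le> snd (D (y, \<tau>)) \<and> snd (D (y, \<tau>)) \<le> \<tau> \<and>
        dist (fst (D (y, \<tau>))) y \<le> \<tau> - snd (D (y, \<tau>)) \<and>
        f (fst (D (y, \<tau>))) \<le> f y - \<sigma> * (\<tau> - snd (D (y, \<tau>))))"

lemma budget_flowD:
  assumes "budget_flow act f \<sigma> D" "0 \<le> \<tau>"
  shows "D (act g y, \<tau>) = (act g (fst (D (y, \<tau>))), snd (D (y, \<tau>)))"
    and "0 \<le> snd (D (y, \<tau>))" and "snd (D (y, \<tau>)) \<le> \<tau>"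
    and "dist (fst (D (y, \<tau>))) y \<le> \<tau> - snd (D (y, \<tau>))"
    and "f (fst (D (y, \<tau>))) \<le> f y - \<sigma> * (\<tau> - snd (D (y, \<tau>)))"
  using assms unfolding budget_flow_def by blast+

lemma budget_flow_id: "budget_flow act f \<sigma> id"
  unfolding budget_flow_def by (auto intro: continuous_on_id')

lemma budget_flow_comp:
  assumes D: "budget_flow act f \<sigma> D" and D': "budget_flow act f \<sigma> D'"
  shows "budget_flow act f \<sigma> (D' \<circ> D)"
  unfolding budget_flow_def
proof (intro conjI allI impI)
  have "D ` (UNIV \<times> {0..}) \<subseteq> UNIV \<times> {0..}"
    using budget_flowD(2)[OF D] by (auto simp: mem_Times_iff simp del: split_paired_All) (metis snd_conv)
  then show "continuous_on (UNIV \<times> {0..}) (D' \<circ> D)"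
    using D D' unfolding budget_flow_def
    by (meson continuous_on_compose continuous_on_subset)
next
  fix g y and \<tau> :: real assume \<tau>: "0 \<le> \<tau>"
  note 1 = budget_flowD[OF D \<tau>, where y = y]
  note 2 = budget_flowD[OF D' 1(2), where y = "fst (D (y, \<tau>))"]
  show "(D' \<circ> D) (act g y, \<tau>) = (act g (fst ((D' \<circ> D) (y, \<tau>))), snd ((D' \<circ> D) (y, \<tau>)))"
    using 1(1)[of g] 2(1)[of g] by simp
  show "0 \<le> snd ((D' \<circ> D) (y, \<tau>))" "snd ((D' \<circ> D) (y, \<tau>)) \<le> \<tau>"
    using 1 2 by simp_all
  show "dist (fst ((D' \<circ> D) (y, \<tau>))) y \<le> \<tau> - snd ((D' \<circ> D) (y, \<tau>))"
    using 1(4) 2(4) dist_triangle[of "fst (D' (D (y, \<tau>)))" y "fst (D (y, \<tau>))"] by simp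
  show "f (fst ((D' \<circ> D) (y, \<tau>))) \<le> f y - \<sigma> * (\<tau> - snd ((D' \<circ> D) (y, \<tau>)))"
    using 1(5) 2(5) by (simp add: algebra_simps)
qed

text \<open>
  The gauge is the distance to the complement, which is invariant because the action is isometric.
  If the complement is empty, \<open>infdist\<close> would be the constant \<open>0\<close>, so a constant \<open>1\<close> is used instead.
\<close>

lemma invariant_open_gauge:
  fixes act :: "'g::topological_group_add \<Rightarrow> 'e::real_normed_vector \<Rightarrow> 'e"
  assumes iso: "isometric_action act" and inv: "invariant_set act W" and "open W"
  obtains w :: "'e \<Rightarrow> real" where "\<And>y z. w y - dist y z \<le> w z"
    and "\<And>y. 0 < w y \<longleftrightarrow> y \<in> W" and "\<And>g y. w (act g y) = w y"
    and "\<And>y. 0 \<le> w y"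
proof (cases "W = UNIV")
  case True
  then show ?thesis using that[of "\<lambda>_. 1"] by simp
next
  case False
  have inv': "invariant_set act (- W)"
    using invariant_set_Compl[OF isometric_imp_linear_action[OF iso] inv] .
  show ?thesis
  proof (rule that[of "\<lambda>y. infdist y (- W)"])
    show "infdist y (- W) - dist y z \<le> infdist z (- W)" for y z
      using infdist_triangle[of y "- W" z] by simp
    have "infdist y (- W) = 0 \<longleftrightarrow> y \<in> - W" for y
      using in_closed_iff_infdist_zero[of "- W" y] False \<open>open W\<close> by auto
    then show "0 < infdist y (- W) \<longleftrightarrow> y \<in> W" for y
      using infdist_nonneg[of y "- W"] by (metis Compl_iff less_eq_real_def less_irrefl)
    show "infdist (act g y) (- W) = infdist y (- W)" for g y
      by (rule infdist_invariant[OF iso inv'])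
  qed (rule infdist_nonneg)
qed

text \<open>
  At \<open>y\<close> the deformation given by the weak slope runs for time \<open>min \<tau> (w y)\<close>, where \<open>w\<close> is a
  gauge of the neighbourhood \<open>U\<close>. As \<open>w\<close> tends to \<open>0\<close> towards the boundary and displacement is
  bounded by time, the identity outside \<open>U\<close> is a continuous extension. The one-sided Lipschitz
  bound on \<open>w\<close> lets the flow still spend the remaining time after other flows have moved the point.
\<close>

lemma local_budget_flow:
  fixes act :: "'g::topological_group_add \<Rightarrow> 'e::real_normed_vector \<Rightarrow> 'e"
  assumes iso: "isometric_action act" and "0 \<le> \<sigma>" and slope: "ennreal \<sigma> < weak_slope act f u"
  obtains D w where "budget_flow act f \<sigma> D" and "\<And>y z. w y - dist y z \<le> w z" and "0 < w u"
    and "\<And>y \<tau>. 0 \<le> \<tau> \<Longrightarrow> \<tau> \<le> w y \<Longrightarrow> snd (D (y, \<tau>)) = 0"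
proof -
  obtain \<sigma>' U \<delta> H where \<sigma>': "ennreal \<sigma> < ennreal \<sigma>'" "0 \<le> \<sigma>'"
    and U: "invariant_set act U" "u \<in> interior U" and \<delta>: "0 < \<delta>"
    and H: "continuous_on (U \<times> {0..\<delta>}) (\<lambda>(v, t). H v t)"
    and Heq: "\<forall>t\<in>{0..\<delta>}. equivariant_on U act act (\<lambda>v. H v t)"
    and Hf: "\<forall>v\<in>U. \<forall>t\<in>{0..\<delta>}. dist (H v t) v \<le> t \<and> f (H v t) \<le> f v - \<sigma>' * t"
    using slope unfolding weak_slope_def less_Sup_iff by blast
  have le: "\<sigma> \<le> \<sigma>'" using \<sigma>' \<open>0 \<le> \<sigma>\<close> by (simp add: ennreal_less_iff)
  let ?W = "interior U"
  have Winv: "invariant_set act ?W" by (rule invariant_set_interior[OF iso U(1)])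
  have Wact: "act g y \<in> ?W \<longleftrightarrow> y \<in> ?W" for g y
    by (rule invariant_set_iff[OF isometric_imp_linear_action[OF iso] Winv])
  obtain w0 where w0: "\<And>y z. w0 y - dist y z \<le> w0 z" "\<And>y. 0 < w0 y \<longleftrightarrow> y \<in> ?W"
      "\<And>g y. w0 (act g y) = w0 y" "\<And>y. (0::real) \<le> w0 y"
    using invariant_open_gauge[OF iso Winv open_interior] by blast
  define w where "w y = min \<delta> (w0 y)" for y
  have w1: "w y - dist y z \<le> w z" for y z
    using w0(1)[of y z] zero_le_dist[of y z] unfolding w_def by linarith
  have w2: "0 < w y \<longleftrightarrow> y \<in> ?W" for y using w0(2)[of y] \<delta> by (auto simp: w_def)
  have w3: "w (act g y) = w y" for g y by (simp add: w_def w0)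
  have w4: "0 \<le> w y" "w y \<le> \<delta>" for y using w0(4)[of y] \<delta> by (auto simp: w_def)
  have wcont: "continuous_on S w" for S
    using one_sided_lipschitz_continuous[OF w1] .
  define s where "s = (\<lambda>(y, \<tau>). min \<tau> (w y))"
  have scont: "continuous_on S s" for S
    unfolding s_def split_beta by (intro continuous_intros continuous_on_compose2[OF wcont[of UNIV]]) auto
  have s: "s (y, \<tau>) \<in> {0..\<delta>}" "s (y, \<tau>) \<le> \<tau>" "0 \<le> s (y, \<tau>)" if "0 \<le> \<tau>" for y \<tau>
    using that w4[of y] by (auto simp: s_def)
  \<comment> \<open>Continuity of the position \<open>p\<close> off \<open>interior U\<close> comes from \<open>dist (p (y, \<tau>)) y \<le> s (y, \<tau>)\<close> and \<open>s = 0\<close> there.\<close>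
  define p where "p = (\<lambda>(y, \<tau>). if y \<in> ?W then H y (s (y, \<tau>)) else y)"
  define D where "D = (\<lambda>z. (p z, snd z - s z))"
  have pd: "dist (p (y, \<tau>)) y \<le> s (y, \<tau>)" if "0 \<le> \<tau>" for y \<tau>
    using Hf s[OF that, of y] interior_subset[of U] by (auto simp: p_def)
  have pcont: "continuous_on (UNIV \<times> {0..}) p"
    unfolding continuous_on_eq_continuous_within
  proof
    fix z :: "'e \<times> real" assume z: "z \<in> UNIV \<times> {0..}"
    obtain y \<tau> where zy: "z = (y, \<tau>)" "0 \<le> \<tau>" using z by auto
    show "continuous (at z within UNIV \<times> {0..}) p"
    proof (cases "y \<in> ?W")
      case True
      have "continuous_on (?W \<times> {0..}) (\<lambda>x. (case (fst x, s x) of (v, t) \<Rightarrow> H v t))"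
        by (rule continuous_on_compose2[OF H])
           (use s interior_subset[of U] in \<open>auto intro!: continuous_intros scont\<close>)
      then have "continuous_on (?W \<times> {0..}) p"
        by (rule continuous_on_eq) (auto simp: p_def)
      then have "continuous (at z within ?W \<times> {0..}) p"
        using True zy by (simp add: continuous_on_eq_continuous_within)
      moreover have "at z within ?W \<times> {0..} = at z within UNIV \<times> {0..}"
        by (rule at_within_nhd[of _ "?W \<times> UNIV"]) (use True zy in \<open>auto intro: open_Times\<close>)
      ultimately show ?thesis by simp
    next
      case False
      have pz: "p z = y" "s z = 0"
        using False zy w2[of y] w4[of y] by (auto simp: p_def s_def)
      have "((\<lambda>x. s x + dist (fst x) y) \<longlongrightarrow> s z + dist (fst z) y) (at z within UNIV \<times> {0..})"
        using scont[of "UNIV \<times> {0..}"] z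
        by (intro tendsto_intros) (auto simp: continuous_on_def)
      then have lim: "((\<lambda>x. s x + dist (fst x) y) \<longlongrightarrow> 0) (at z within UNIV \<times> {0..})"
        using pz zy by simp
      have ev: "\<forall>\<^sub>F x in at z within UNIV \<times> {0..}. dist (p x) y \<le> s x + dist (fst x) y"
      proof -
        have "dist (p x) y \<le> s x + dist (fst x) y" if "x \<in> UNIV \<times> {0..}" for x
          using pd[of "snd x" "fst x"] that dist_triangle[of "p x" y "fst x"] by auto
        then show ?thesis by (auto simp: eventually_at_filter)
      qed
      have "((\<lambda>x. dist (p x) y) \<longlongrightarrow> 0) (at z within UNIV \<times> {0..})"
        by (rule tendsto_sandwich[OF _ ev tendsto_const lim]) auto
      then show ?thesis
        unfolding continuous_within pz by (subst tendsto_dist_iff)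
    qed
  qed
  show ?thesis
  proof (rule that[of D w])
    show "budget_flow act f \<sigma> D"
      unfolding budget_flow_def
    proof (intro conjI allI impI)
      show "continuous_on (UNIV \<times> {0..}) D"
        unfolding D_def by (intro continuous_intros pcont scont)
    next
      fix g y and \<tau> :: real assume \<tau>: "0 \<le> \<tau>"
      have "s (act g y, \<tau>) = s (y, \<tau>)" by (simp add: s_def w3)
      moreover have "p (act g y, \<tau>) = act g (p (y, \<tau>))"
        using Heq s[OF \<tau>, of y] calculation Wact[of g y] interior_subset[of U]
        by (auto simp: p_def equivariant_on_def)
      ultimately show "D (act g y, \<tau>) = (act g (fst (D (y, \<tau>))), snd (D (y, \<tau>)))"
        by (simp add: D_def)
      show "0 \<le> snd (D (y, \<tau>))" "snd (D (y, \<tau>)) \<le> \<tau>" "dist (fst (D (y, \<tau>))) y \<le> \<tau> - snd (D (y, \<tau>))"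
        using s[OF \<tau>, of y] pd[OF \<tau>, of y] by (simp_all add: D_def)
      have "f (p (y, \<tau>)) \<le> f y - \<sigma>' * s (y, \<tau>)"
      proof (cases "y \<in> ?W")
        case True
        then show ?thesis using Hf s[OF \<tau>, of y] interior_subset[of U] by (auto simp: p_def)
      next
        case False
        then have "w y = 0" using w2[of y] w4(1)[of y] by simp
        then show ?thesis using False \<tau> by (simp add: p_def s_def)
      qed
      also have "\<dots> \<le> f y - \<sigma> * s (y, \<tau>)"
        using le s[OF \<tau>, of y] by (simp add: mult_right_mono)
      finally show "f (fst (D (y, \<tau>))) \<le> f y - \<sigma> * (\<tau> - snd (D (y, \<tau>)))"
        by (simp add: D_def)
    qed
    show "w y - dist y z \<le> w z" for y z by (rule w1)
    show "0 < w u" using w2 U by blast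
    show "snd (D (y, \<tau>)) = 0" if "0 \<le> \<tau>" "\<tau> \<le> w y" for y \<tau>
      using that by (simp add: D_def s_def)
  qed
qed

text \<open>
  Compose the local flows of a finite subcover. The gauge of at least one of them
  is no less than the budget at the starting point. When its turn comes, the point has moved no further
  than the time already spent, so the gauge is still no less than the time that is left, and all of it
  is spent.
\<close>

lemma budget_flow_exhausting_near_compact:
  fixes act :: "'g::topological_group_add \<Rightarrow> 'e::real_normed_vector \<Rightarrow> 'e"
  assumes iso: "isometric_action act" and "0 \<le> \<sigma>" and "compact C"
    and slope: "\<And>u. u \<in> C \<Longrightarrow> ennreal \<sigma> < weak_slope act f u"
  obtains D W s where "budget_flow act f \<sigma> D" and "open W" and "C \<subseteq> W" and "0 < s"
    and "\<And>y \<tau>. y \<in> W \<Longrightarrow> 0 \<le> \<tau> \<Longrightarrow> \<tau> \<le> s \<Longrightarrow> snd (D (y, \<tau>)) = 0"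
proof -
  have "\<forall>u\<in>C. \<exists>D w. budget_flow act f \<sigma> D \<and> (\<forall>y z. w y - dist y z \<le> w z) \<and> 0 < w u \<and>
          (\<forall>y \<tau>. 0 \<le> \<tau> \<longrightarrow> \<tau> \<le> w y \<longrightarrow> snd (D (y, \<tau>)) = 0)"
    using local_budget_flow[OF iso \<open>0 \<le> \<sigma>\<close> slope] by metis
  then obtain D w where D: "\<And>u. u \<in> C \<Longrightarrow> budget_flow act f \<sigma> (D u)"
    and w: "\<And>u y z. u \<in> C \<Longrightarrow> w u y - dist y z \<le> w u z" "\<And>u. u \<in> C \<Longrightarrow> 0 < w u u"
    and Dw: "\<And>u y \<tau>. u \<in> C \<Longrightarrow> 0 \<le> \<tau> \<Longrightarrow> \<tau> \<le> w u y \<Longrightarrow> snd (D u (y, \<tau>)) = 0"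
    by metis
  have many: "\<exists>D'. budget_flow act f \<sigma> D' \<and>
      (\<forall>y \<tau>. 0 \<le> \<tau> \<longrightarrow> (\<exists>u\<in>J. \<tau> \<le> w u y) \<longrightarrow> snd (D' (y, \<tau>)) = 0)"
    if "finite J" "J \<subseteq> C" for J
    using that
  proof (induction J rule: finite_induct)
    case empty
    show ?case by (intro exI[of _ id] conjI budget_flow_id) auto
  next
    case (insert u J)
    then obtain D' where D': "budget_flow act f \<sigma> D'"
      and ex: "\<And>y \<tau>. 0 \<le> \<tau> \<Longrightarrow> \<exists>v\<in>J. \<tau> \<le> w v y \<Longrightarrow> snd (D' (y, \<tau>)) = 0" by auto
    have u: "u \<in> C" using insert by auto
    have "snd ((D u \<circ> D') (y, \<tau>)) = 0" if \<tau>: "0 \<le> \<tau>" and v: "v \<in> insert u J" "\<tau> \<le> w v y" for y \<tau> v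
    proof -
      define z \<tau>' where "z = fst (D' (y, \<tau>))" and "\<tau>' = snd (D' (y, \<tau>))"
      have zt: "D' (y, \<tau>) = (z, \<tau>')" by (simp add: z_def \<tau>'_def)
      have \<tau>': "0 \<le> \<tau>'" "dist z y \<le> \<tau> - \<tau>'"
        using budget_flowD[OF D' \<tau>, where y = y] by (auto simp: z_def \<tau>'_def)
      show ?thesis
      proof (cases "v = u")
        case True
        then have "\<tau>' \<le> w u z"
          using w(1)[OF u, of y z] \<tau>' v by (simp add: dist_commute)
        then show ?thesis using Dw[OF u \<tau>'(1)] zt by simp
      next
        case False
        then have "\<tau>' = 0" using ex[OF \<tau>] v by (auto simp: \<tau>'_def)
        then show ?thesis using budget_flowD(2,3)[OF D[OF u] \<tau>'(1), of z] zt by simp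
      qed
    qed
    then show ?case
      using budget_flow_comp[OF D' D[OF u]] by blast
  qed
  have op: "open {y. w u u / 2 < w u y}" if "u \<in> C" for u
  proof -
    have "continuous_on UNIV (w u)"
      using one_sided_lipschitz_continuous[OF w(1)[OF that]] .
    then show ?thesis by (intro open_Collect_less continuous_on_const)
  qed
  obtain J where J: "finite J" "J \<subseteq> C" "C \<subseteq> (\<Union>u\<in>J. {y. w u u / 2 < w u y})"
    using compactE_image[OF \<open>compact C\<close>, of C "\<lambda>u. {y. w u u / 2 < w u y}"] op w(2) by force
  define s where "s = Min (insert 1 ((\<lambda>u. w u u / 2) ` J))"
  have s: "0 < s" "\<And>u. u \<in> J \<Longrightarrow> s \<le> w u u / 2"
    using J w(2) by (auto simp: s_def intro!: Min_le simp del: le_divide_eq_numeral1)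
  obtain D' where D': "budget_flow act f \<sigma> D'"
    and ex: "\<And>y \<tau>. 0 \<le> \<tau> \<Longrightarrow> \<exists>v\<in>J. \<tau> \<le> w v y \<Longrightarrow> snd (D' (y, \<tau>)) = 0"
    using many[OF J(1,2)] by blast
  show ?thesis
  proof (rule that[OF D' _ J(3) s(1)])
    show "open (\<Union>u\<in>J. {y. w u u / 2 < w u y})" using op J by blast
    show "snd (D' (y, \<tau>)) = 0"
      if y: "y \<in> (\<Union>u\<in>J. {y. w u u / 2 < w u y})" and "0 \<le> \<tau>" "\<tau> \<le> s" for y \<tau>
    proof -
      obtain u where u: "u \<in> J" "w u u / 2 < w u y" using y by auto
      have "\<tau> \<le> w u y" using s(2)[OF u(1)] u(2) that(3) by linarith
      then show ?thesis using ex[OF that(2)] u(1) by blast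
    qed
  qed
qed

text \<open>
  The data witnessing a positive slope at \<open>l\<close> serve every point in the interior of the same
  neighbourhood, so the slope is lower semicontinuous.
\<close>

lemma weak_slope_eq_0_limit:
  assumes u: "u \<longlonglongrightarrow> l" and slope: "(\<lambda>n. weak_slope act f (u n)) \<longlonglongrightarrow> 0"
  shows "weak_slope act f l = 0"
proof (rule ccontr)
  assume "weak_slope act f l \<noteq> 0"
  then have "0 < weak_slope act f l" by (simp add: zero_less_iff_neq_zero)
  then obtain \<sigma> U \<delta> H where \<sigma>: "0 < ennreal \<sigma>" "0 \<le> \<sigma>"
    and l: "l \<in> interior U" and data: "invariant_set act U" "0 < \<delta>"
      "continuous_on (U \<times> {0..\<delta>}) (\<lambda>(v, t). H v t)"
      "\<forall>t\<in>{0..\<delta>}. equivariant_on U act act (\<lambda>v. H v t)"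
      "\<forall>v\<in>U. \<forall>t\<in>{0..\<delta>}. dist (H v t) v \<le> t \<and> f (H v t) \<le> f v - \<sigma> * t"
    unfolding weak_slope_def less_Sup_iff by blast
  have "ennreal \<sigma> \<le> weak_slope act f v" if "v \<in> interior U" for v
    unfolding weak_slope_def using \<sigma>(2) data that by (intro Sup_upper) blast
  moreover have "\<forall>\<^sub>F n in sequentially. u n \<in> interior U"
    using topological_tendstoD[OF u open_interior l] .
  ultimately have "\<forall>\<^sub>F n in sequentially. ennreal \<sigma> \<le> weak_slope act f (u n)"
    by (auto elim: eventually_mono)
  then have "ennreal \<sigma> \<le> 0"
    using tendsto_lowerbound[OF slope] by simp
  then show False using \<sigma> by simp
qed

text \<open>
  The budget is \<open>\<tau>\<close> at heights above \<open>(M + L) / 2\<close> and fades out to \<open>0\<close> at height \<open>L\<close>.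
  Points of \<open>K\<close> near the level \<open>M\<close> spend all of \<open>\<tau>\<close>; all others already lie
  below \<open>M\<close> by a margin at least \<open>\<sigma> * \<tau>\<close> when \<open>\<tau>\<close> is small. The cutoff is a function of \<open>f\<close>, hence invariant.
\<close>

lemma equivariant_push_down:
  fixes act :: "'g::topological_group_add \<Rightarrow> 'e::real_normed_vector \<Rightarrow> 'e"
  assumes iso: "isometric_action act" and f_cont: "continuous_on UNIV f" and f_inv: "invariant_fun act f"
    and "0 < \<sigma>" and "compact K" and le: "\<And>y. y \<in> K \<Longrightarrow> f y \<le> M" and "L < M"
    and slope: "\<And>y. y \<in> K \<Longrightarrow> f y = M \<Longrightarrow> ennreal \<sigma> < weak_slope act f y"
  obtains Q \<tau> where "0 < \<tau>" and "continuous_on UNIV Q" and "equivariant_on UNIV act act Q"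
    and "\<And>y. f y \<le> L \<Longrightarrow> Q y = y" and "\<And>y. dist (Q y) y \<le> \<tau>"
    and "\<And>y. y \<in> K \<Longrightarrow> f (Q y) \<le> M - \<sigma> * \<tau>"
proof -
  have "closed {y. f y = M}"
    using f_cont by (intro closed_Collect_eq) auto
  then have C: "compact (K \<inter> {y. f y = M})" using \<open>compact K\<close> by blast
  obtain D W s where D: "budget_flow act f \<sigma> D" and W: "open W" "K \<inter> {y. f y = M} \<subseteq> W" and "0 < s"
    and ex: "\<And>y \<tau>. y \<in> W \<Longrightarrow> 0 \<le> \<tau> \<Longrightarrow> \<tau> \<le> s \<Longrightarrow> snd (D (y, \<tau>)) = 0"
    by (rule budget_flow_exhausting_near_compact[OF iso less_imp_le[OF \<open>0 < \<sigma>\<close>] C, of f])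
      (use slope in auto)
  have "\<exists>\<eta>>0. \<forall>y\<in>K - W. f y \<le> M - \<eta>"
  proof (cases "K - W = {}")
    case False
    have "compact (K - W)" using \<open>compact K\<close> W(1) by (rule compact_diff)
    then obtain z where z: "z \<in> K - W" "\<And>y. y \<in> K - W \<Longrightarrow> f y \<le> f z"
      using continuous_attains_sup[of "K - W" f] False continuous_on_subset[OF f_cont] by blast
    have "f z < M" using z(1) W(2) le[of z] by force
    then show ?thesis using z(2) by (intro exI[of _ "M - f z"]) auto
  next
    case True
    then show ?thesis by (intro exI[of _ 1]) auto
  qed
  then obtain \<eta> where \<eta>: "0 < \<eta>" "\<And>y. y \<in> K \<Longrightarrow> y \<notin> W \<Longrightarrow> f y \<le> M - \<eta>" by auto
  define \<tau> where "\<tau> = min s (min \<eta> ((M - L) / 2) / \<sigma>)"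
  have \<tau>: "0 < \<tau>" "\<tau> \<le> s" using \<open>0 < s\<close> \<eta> \<open>L < M\<close> \<open>0 < \<sigma>\<close> by (auto simp: \<tau>_def)
  have "\<tau> \<le> min \<eta> ((M - L) / 2) / \<sigma>" by (simp add: \<tau>_def)
  then have "\<sigma> * \<tau> \<le> min \<eta> ((M - L) / 2)" using \<open>0 < \<sigma>\<close> by (simp add: pos_le_divide_eq mult.commute)
  then have \<sigma>\<tau>: "\<sigma> * \<tau> \<le> \<eta>" "\<sigma> * \<tau> \<le> (M - L) / 2" by auto
  define \<psi> where "\<psi> y = max 0 (min 1 (2 * (f y - L) / (M - L)))" for y
  have \<psi>: "0 \<le> \<psi> y" "\<psi> y \<le> 1" for y by (auto simp: \<psi>_def)
  have \<psi>0: "\<psi> y = 0" if "f y \<le> L" for y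
  proof -
    have "2 * (f y - L) / (M - L) \<le> 0"
      using that \<open>L < M\<close> by (intro divide_nonpos_pos) auto
    then show ?thesis by (auto simp: \<psi>_def)
  qed
  have \<psi>1: "\<psi> y = 1" if "(M + L) / 2 \<le> f y" for y
  proof -
    have "1 \<le> 2 * (f y - L) / (M - L)"
      using that \<open>L < M\<close> by (simp add: pos_le_divide_eq field_simps)
    then show ?thesis by (auto simp: \<psi>_def)
  qed
  have \<psi>inv: "\<psi> (act g y) = \<psi> y" for g y
    using f_inv by (simp add: \<psi>_def invariant_fun_def fun_eq_iff)
  have \<psi>cont: "continuous_on UNIV \<psi>"
    unfolding \<psi>_def using \<open>L < M\<close> by (intro continuous_intros f_cont) auto
  define Q where "Q y = fst (D (y, \<tau> * \<psi> y))" for y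
  have nn: "0 \<le> \<tau> * \<psi> y" "\<tau> * \<psi> y \<le> \<tau>" for y
    using \<tau> \<psi>[of y] by (auto intro: mult_left_le)
  note flow = budget_flowD[OF D nn(1)]
  have fQ: "f (Q y) \<le> f y" for y
  proof -
    have "0 \<le> \<sigma> * (\<tau> * \<psi> y - snd (D (y, \<tau> * \<psi> y)))"
      using flow(3)[of y y] \<open>0 < \<sigma>\<close> by simp
    then show ?thesis using flow(5)[of y y] by (simp add: Q_def)
  qed
  show ?thesis
  proof (rule that[of \<tau> Q])
    show "continuous_on UNIV Q"
    proof -
      have "continuous_on (UNIV \<times> {0..}) D" using D by (simp add: budget_flow_def)
      then have "continuous_on UNIV (\<lambda>y. D (y, \<tau> * \<psi> y))"
        by (rule continuous_on_compose2) (use nn in \<open>auto intro!: continuous_intros \<psi>cont\<close>)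
      then show ?thesis unfolding Q_def by (rule continuous_on_fst)
    qed
    show "equivariant_on UNIV act act Q"
      using flow(1) by (simp add: equivariant_on_def Q_def \<psi>inv)
    show "dist (Q y) y \<le> \<tau>" for y
      using flow(2,4)[of y y] nn(2)[of y] by (simp add: Q_def)
    show "Q y = y" if "f y \<le> L" for y
    proof -
      have "\<tau> * \<psi> y = 0" using \<psi>0[OF that] by simp
      then have "dist (Q y) y \<le> 0" using flow(2,4)[of y y] unfolding Q_def by linarith
      then show ?thesis by simp
    qed
    show "f (Q y) \<le> M - \<sigma> * \<tau>" if "y \<in> K" for y
    proof -
      consider "y \<notin> W" | "f y \<le> (M + L) / 2" | "y \<in> W" "(M + L) / 2 \<le> f y" by linarith
      then show ?thesis
      proof cases
        case 1
        then show ?thesis using \<eta>(2)[OF that] \<sigma>\<tau> fQ[of y] by linarith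
      next
        case 2
        then show ?thesis using \<sigma>\<tau>(2) fQ[of y] by (simp add: field_simps)
      next
        case 3
        then have "snd (D (y, \<tau> * \<psi> y)) = 0" using ex[OF 3(1)] \<tau> \<psi>1 by simp
        then show ?thesis
          using flow(5)[of y y] \<psi>1[OF 3(2)] le[OF that] by (simp add: Q_def)
      qed
    qed
  qed (rule \<tau>)
qed

section \<open>An ordering principle\<close>

text \<open>
  Descend along the order, at each step to within \<open>(1/2)^n\<close> of the infimum of \<open>F\<close> below the
  current point. A lower bound \<open>x\<close> of the chain lies below all of these points, so nothing below
  \<open>x\<close> can have a smaller value than \<open>F x\<close>.
\<close>

lemma brezis_browder:
  fixes F :: "'x \<Rightarrow> real"
  assumes refl: "\<And>x. x \<in> S \<Longrightarrow> R x x"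
    and trans: "\<And>x y z. R x y \<Longrightarrow> R y z \<Longrightarrow> R x z"
    and mono: "\<And>x y. R x y \<Longrightarrow> F x \<le> F y"
    and bdd: "\<And>x. x \<in> S \<Longrightarrow> m \<le> F x"
    and chain: "\<And>X. (\<And>n :: nat. X n \<in> S) \<Longrightarrow> (\<And>n. R (X (Suc n)) (X n)) \<Longrightarrow> \<exists>x\<in>S. \<forall>n. R x (X n)"
    and x0: "x0 \<in> S"
  obtains x where "x \<in> S" and "R x x0" and "\<And>y. y \<in> S \<Longrightarrow> R y x \<Longrightarrow> F y = F x"
proof -
  define below where "below x = {y \<in> S. R y x}" for x
  have bb: "bdd_below (F ` below x)" for x
    using bdd by (auto simp: below_def intro!: bdd_belowI[of _ m])
  have step: "\<exists>y. y \<in> below x \<and> F y < (INF z\<in>below x. F z) + (1/2)^n" if "x \<in> S" for x and n :: nat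
  proof -
    have "below x \<noteq> {}" using refl that by (auto simp: below_def)
    then show ?thesis using cInf_lessD[of "F ` below x" "(INF z\<in>below x. F z) + (1/2)^n"] by auto
  qed
  obtain X where X: "X 0 = x0" "\<And>n. X n \<in> S"
    "\<And>n. X (Suc n) \<in> below (X n) \<and> F (X (Suc n)) < (INF z\<in>below (X n). F z) + (1/2)^n"
  proof -
    have "\<exists>X. \<forall>n. (X n \<in> S \<and> (n = 0 \<longrightarrow> X n = x0)) \<and>
       (X (Suc n) \<in> below (X n) \<and> F (X (Suc n)) < (INF z\<in>below (X n). F z) + (1/2)^n)"
      by (rule dependent_nat_choice) (use x0 step in \<open>fastforce simp: below_def\<close>)+
    then show ?thesis using that by blast
  qed
  have dec: "R (X (Suc n)) (X n)" for n using X(3)[of n] by (simp add: below_def)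
  obtain x where x: "x \<in> S" "\<And>n. R x (X n)" using chain[of X] X(2) dec by blast
  show ?thesis
  proof (rule that[OF x(1)])
    show "R x x0" using x(2)[of 0] X(1) by simp
    fix y assume y: "y \<in> S" "R y x"
    have "F x \<le> F y + (1/2)^n" for n
    proof -
      have "y \<in> below (X n)" using y trans x(2) by (auto simp: below_def)
      then have "(INF z\<in>below (X n). F z) \<le> F y" by (rule cINF_lower[OF bb])
      then show ?thesis using X(3)[of n] mono[OF x(2)[of "Suc n"]] by linarith
    qed
    moreover have "(\<lambda>n. F y + (1/2)^n) \<longlonglongrightarrow> F y + 0"
      by (intro tendsto_intros LIMSEQ_power_zero) auto
    ultimately have "F x \<le> F y" using LIMSEQ_le_const by fastforce
    then show "F y = F x" using mono[OF y(2)] by simp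
  qed
qed

section \<open>The minimax principle\<close>

definition equivariant_maps_rel ::
  "('g \<Rightarrow> 'e::real_normed_vector \<Rightarrow> 'e) \<Rightarrow> 'e set \<Rightarrow> 'e set \<Rightarrow> ('e \<Rightarrow> 'e) set" where
  "equivariant_maps_rel act B A =
     {\<gamma>. continuous_on B \<gamma> \<and> equivariant_on B act act \<gamma> \<and> (\<forall>x\<in>A. \<gamma> x = x)}"

lemma equivariant_maps_rel_complete:
  fixes act :: "'g::topological_group_add \<Rightarrow> 'e::banach \<Rightarrow> 'e"
  assumes iso: "isometric_action act" and inv: "invariant_set act B" and "A \<subseteq> B"
    and \<gamma>: "\<And>n. \<gamma> n \<in> equivariant_maps_rel act B A"
    and lim: "uniform_limit B \<gamma> g sequentially"
  shows "g \<in> equivariant_maps_rel act B A"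
  unfolding equivariant_maps_rel_def
proof (intro CollectI conjI ballI)
  note pw = tendsto_uniform_limitI[OF lim]
  show "continuous_on B g"
    using uniform_limit_theorem[OF _ lim] \<gamma> by (simp add: equivariant_maps_rel_def)
  show "equivariant_on B act act g"
    unfolding equivariant_on_def
  proof (intro allI ballI)
    fix h x assume x: "x \<in> B"
    then have hx: "act h x \<in> B"
      using invariant_set_iff[OF isometric_imp_linear_action[OF iso] inv] by blast
    have "isCont (act h) (g x)"
      using isometric_action_continuous[OF iso, of UNIV h] by (simp add: continuous_on_eq_continuous_at)
    then have "(\<lambda>n. act h (\<gamma> n x)) \<longlonglongrightarrow> act h (g x)"
      using pw[OF x] by (rule isCont_tendsto_compose)
    moreover have "act h (\<gamma> n x) = \<gamma> n (act h x)" for n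
      using \<gamma>[of n] x by (simp add: equivariant_maps_rel_def equivariant_on_def)
    ultimately show "g (act h x) = act h (g x)"
      using pw[OF hx] LIMSEQ_unique by auto
  qed
  fix x assume x: "x \<in> A"
  then have "\<gamma> n x = x" for n using \<gamma>[of n] by (simp add: equivariant_maps_rel_def)
  then show "g x = x" using pw[of x] x \<open>A \<subseteq> B\<close> LIMSEQ_unique[of "\<lambda>_. x"] by auto
qed

text \<open>
  For the order \<open>R \<gamma>' \<gamma>\<close> below, a decreasing sequence of maps is uniformly Cauchy because the values
  \<open>F\<close> decrease to a limit, and its uniform limit is a lower bound. A minimal map admits no
  equivariant push-down, so some point at its maximal height has slope at most \<open>\<sigma>\<close>.
\<close>

lemma minimax_almost_critical:
  fixes act :: "'g::topological_group_add \<Rightarrow> 'e::banach \<Rightarrow> 'e"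
  assumes iso: "isometric_action act" and f_cont: "continuous_on UNIV f" and f_inv: "invariant_fun act f"
    and B: "compact B" "B \<noteq> {}" "invariant_set act B" and A: "A \<subseteq> B" "\<And>x. x \<in> A \<Longrightarrow> f x \<le> L"
    and "L < c" and linking: "\<And>\<gamma>. \<gamma> \<in> equivariant_maps_rel act B A \<Longrightarrow> \<exists>x\<in>B. c \<le> f (\<gamma> x)"
  obtains m where "c \<le> m"
    and "\<And>\<sigma>. 0 < \<sigma> \<Longrightarrow> \<exists>u. weak_slope act f u \<le> ennreal \<sigma> \<and> \<bar>f u - m\<bar> \<le> \<sigma>"
proof -
  let ?\<Gamma> = "equivariant_maps_rel act B A"
  define F where "F \<gamma> = (SUP x\<in>B. f (\<gamma> x))" for \<gamma>
  have cont: "continuous_on B (\<lambda>x. f (\<gamma> x))" if "\<gamma> \<in> ?\<Gamma>" for \<gamma>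
    by (rule continuous_on_compose2[OF f_cont]) (use that in \<open>auto simp: equivariant_maps_rel_def\<close>)
  have bdd: "bdd_above ((\<lambda>x. f (\<gamma> x)) ` B)" if "\<gamma> \<in> ?\<Gamma>" for \<gamma>
    by (intro bounded_imp_bdd_above compact_imp_bounded compact_continuous_image cont that B(1))
  have Fub: "f (\<gamma> x) \<le> F \<gamma>" if "\<gamma> \<in> ?\<Gamma>" "x \<in> B" for \<gamma> x
    unfolding F_def by (rule cSUP_upper[OF that(2) bdd[OF that(1)]])
  have Fleast: "F \<gamma> \<le> a" if "\<And>x. x \<in> B \<Longrightarrow> f (\<gamma> x) \<le> a" for \<gamma> a
    unfolding F_def using B(2) that by (rule cSUP_least)
  have Fc: "c \<le> F \<gamma>" if "\<gamma> \<in> ?\<Gamma>" for \<gamma>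
    using linking[OF that] Fub[OF that] by fastforce
  have id: "(\<lambda>x. x) \<in> ?\<Gamma>"
    by (simp add: equivariant_maps_rel_def equivariant_on_def)
  define m where "m = (INF \<gamma>\<in>?\<Gamma>. F \<gamma>)"
  have mlb: "m \<le> F \<gamma>" if "\<gamma> \<in> ?\<Gamma>" for \<gamma>
    unfolding m_def using that Fc by (intro cINF_lower bdd_belowI[of _ c]) auto
  have "c \<le> m" unfolding m_def using id Fc by (intro cINF_greatest) auto
  show ?thesis
  proof (rule that[OF \<open>c \<le> m\<close>])
    fix \<sigma> :: real assume \<sigma>: "0 < \<sigma>"
    \<comment> \<open>\<open>\<gamma>'\<close> lowers the maximum at rate at least \<open>\<sigma>\<close> in the uniform displacement from \<open>\<gamma>\<close>.\<close>
    define R where "R \<gamma>' \<gamma> \<longleftrightarrow> (\<forall>x\<in>B. \<sigma> * dist (\<gamma>' x) (\<gamma> x) \<le> F \<gamma> - F \<gamma>')" for \<gamma>' \<gamma>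
    have Rmono: "F \<gamma>' \<le> F \<gamma>" if R: "R \<gamma>' \<gamma>" for \<gamma>' \<gamma>
    proof -
      obtain x where "x \<in> B" using B(2) by blast
      then have "0 \<le> \<sigma> * dist (\<gamma>' x) (\<gamma> x)" "\<sigma> * dist (\<gamma>' x) (\<gamma> x) \<le> F \<gamma> - F \<gamma>'"
        using \<sigma> R by (auto simp: R_def)
      then show ?thesis by linarith
    qed
    have Rtrans: "R \<alpha> \<gamma>" if "R \<alpha> \<beta>" "R \<beta> \<gamma>" for \<alpha> \<beta> \<gamma>
      unfolding R_def
    proof
      fix x assume x: "x \<in> B"
      have "\<sigma> * dist (\<alpha> x) (\<gamma> x) \<le> \<sigma> * dist (\<alpha> x) (\<beta> x) + \<sigma> * dist (\<beta> x) (\<gamma> x)"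
        using \<sigma> dist_triangle[of "\<alpha> x" "\<gamma> x" "\<beta> x"] by (simp flip: distrib_left)
      then show "\<sigma> * dist (\<alpha> x) (\<gamma> x) \<le> F \<gamma> - F \<alpha>" using that x by (fastforce simp: R_def)
    qed
    have chain: "\<exists>g\<in>?\<Gamma>. \<forall>n. R g (X n)"
      if X: "\<And>n :: nat. X n \<in> ?\<Gamma>" and dec: "\<And>n. R (X (Suc n)) (X n)" for X
    proof -
      have Rle: "R (X q) (X p)" if "p \<le> q" for p q
        using that
      proof (induction q rule: dec_induct)
        case base
        show ?case by (simp add: R_def)
      next
        case (step q)
        then show ?case using Rtrans dec by blast
      qed
      have "decseq (\<lambda>n. F (X n))" using Rmono dec by (simp add: decseq_Suc_iff)
      then obtain l where l: "(\<lambda>n. F (X n)) \<longlonglongrightarrow> l" "\<And>n. l \<le> F (X n)"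
        using decseq_convergent[of "\<lambda>n. F (X n)" c] Fc[OF X] by metis
      have "uniformly_Cauchy_on B X"
        unfolding uniformly_Cauchy_on_def
      proof (intro allI impI)
        fix e :: real assume e: "0 < e"
        then have "\<forall>\<^sub>F n in sequentially. F (X n) < l + \<sigma> * e"
          using \<sigma> by (intro order_tendstoD(2)[OF l(1)]) simp
        then obtain N where N: "F (X N) < l + \<sigma> * e" by (auto simp: eventually_sequentially)
        have near: "dist (X p x) (X q x) < e" if "x \<in> B" "N \<le> p" "p \<le> q" for p q x
        proof -
          have "\<sigma> * dist (X q x) (X p x) \<le> F (X p) - F (X q)"
            using Rle[OF that(3)] that by (simp add: R_def)
          also have "\<dots> < \<sigma> * e" using Rmono[OF Rle[OF that(2)]] l(2)[of q] N by linarith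
          finally show ?thesis using \<sigma> by (simp add: dist_commute)
        qed
        show "\<exists>M. \<forall>x\<in>B. \<forall>m\<ge>M. \<forall>n\<ge>M. dist (X m x) (X n x) < e"
          by (intro exI[of _ N]) (metis near dist_commute linear)
      qed
      then obtain g where g: "uniform_limit B X g sequentially"
        using Cauchy_uniformly_convergent[of B X] by (auto simp: uniformly_convergent_on_def)
      have gG: "g \<in> ?\<Gamma>" by (rule equivariant_maps_rel_complete[OF iso B(3) A(1) X g])
      note pw = tendsto_uniform_limitI[OF g]
      have "F g \<le> l"
      proof (rule Fleast)
        fix x assume x: "x \<in> B"
        have "(\<lambda>n. f (X n x)) \<longlonglongrightarrow> f (g x)"
          using continuous_on_tendsto_compose[OF f_cont pw[OF x]] by simp
        then show "f (g x) \<le> l" using l(1) by (rule LIMSEQ_le) (use Fub[OF X x] in auto)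
      qed
      have "R g (X n)" for n
        unfolding R_def
      proof
        fix x assume x: "x \<in> B"
        have "(\<lambda>q. \<sigma> * dist (X q x) (X n x)) \<longlonglongrightarrow> \<sigma> * dist (g x) (X n x)"
          by (intro tendsto_intros pw[OF x])
        moreover have "\<sigma> * dist (X q x) (X n x) \<le> F (X n) - l" if "n \<le> q" for q
          using Rle[OF that] x l(2)[of q] by (fastforce simp: R_def)
        ultimately have "\<sigma> * dist (g x) (X n x) \<le> F (X n) - l"
          by (intro LIMSEQ_le_const2) auto
        then show "\<sigma> * dist (g x) (X n x) \<le> F (X n) - F g" using \<open>F g \<le> l\<close> by simp
      qed
      then show ?thesis using gG by blast
    qed
    have "\<exists>\<gamma>\<in>?\<Gamma>. F \<gamma> < m + \<sigma>"
      using id \<sigma> cInf_lessD[of "F ` ?\<Gamma>" "m + \<sigma>"] unfolding m_def by auto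
    then obtain \<gamma>0 where \<gamma>0: "\<gamma>0 \<in> ?\<Gamma>" "F \<gamma>0 < m + \<sigma>" by blast
    have "\<exists>\<gamma>\<in>?\<Gamma>. R \<gamma> \<gamma>0 \<and> (\<forall>\<gamma>'\<in>?\<Gamma>. R \<gamma>' \<gamma> \<longrightarrow> F \<gamma>' = F \<gamma>)"
    proof (rule brezis_browder[of ?\<Gamma> R F c \<gamma>0])
      show "R \<gamma> \<gamma>" for \<gamma> by (simp add: R_def)
      show "\<exists>g\<in>?\<Gamma>. \<forall>n. R g (X n)" if "\<And>n :: nat. X n \<in> ?\<Gamma>" "\<And>n. R (X (Suc n)) (X n)" for X
        using chain that by blast
    qed (use Rtrans Rmono Fc \<gamma>0(1) in blast)+
    then obtain \<gamma> where \<gamma>: "\<gamma> \<in> ?\<Gamma>" "R \<gamma> \<gamma>0"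
      and min: "\<And>\<gamma>'. \<gamma>' \<in> ?\<Gamma> \<Longrightarrow> R \<gamma>' \<gamma> \<Longrightarrow> F \<gamma>' = F \<gamma>" by blast
    have K: "compact (\<gamma> ` B)"
      using \<gamma>(1) B(1) by (intro compact_continuous_image) (auto simp: equivariant_maps_rel_def)
    have "\<exists>y\<in>\<gamma> ` B. f y = F \<gamma> \<and> weak_slope act f y \<le> ennreal \<sigma>"
    proof (rule ccontr)
      assume "\<not> ?thesis"
      then have slope: "ennreal \<sigma> < weak_slope act f y" if "y \<in> \<gamma> ` B" "f y = F \<gamma>" for y
        using that not_le by blast
      have LF: "L < F \<gamma>" using \<open>L < c\<close> Fc[OF \<gamma>(1)] by simp
      obtain Q \<tau> where \<tau>: "0 < \<tau>" and Q: "continuous_on UNIV Q" "equivariant_on UNIV act act Q"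
        "\<And>y. f y \<le> L \<Longrightarrow> Q y = y" "\<And>y. dist (Q y) y \<le> \<tau>"
        "\<And>y. y \<in> \<gamma> ` B \<Longrightarrow> f (Q y) \<le> F \<gamma> - \<sigma> * \<tau>"
        by (rule equivariant_push_down[OF iso f_cont f_inv \<sigma> K, of "F \<gamma>" L])
          (use LF slope Fub[OF \<gamma>(1)] in auto)
      let ?\<gamma>' = "\<lambda>x. Q (\<gamma> x)"
      have \<gamma>': "?\<gamma>' \<in> ?\<Gamma>"
        using \<gamma>(1) Q A continuous_on_compose2[OF Q(1), of B \<gamma>]
        by (auto simp: equivariant_maps_rel_def equivariant_on_def)
      have F': "F ?\<gamma>' \<le> F \<gamma> - \<sigma> * \<tau>" by (rule Fleast) (use Q(5) in auto)
      have "R ?\<gamma>' \<gamma>"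
        unfolding R_def
      proof
        fix x
        have "\<sigma> * dist (Q (\<gamma> x)) (\<gamma> x) \<le> \<sigma> * \<tau>" using Q(4) \<sigma> by simp
        then show "\<sigma> * dist (Q (\<gamma> x)) (\<gamma> x) \<le> F \<gamma> - F ?\<gamma>'" using F' by linarith
      qed
      then have "F ?\<gamma>' = F \<gamma>" using min \<gamma>' by blast
      then show False using F' mult_pos_pos[OF \<sigma> \<tau>] by linarith
    qed
    then obtain u where "f u = F \<gamma>" "weak_slope act f u \<le> ennreal \<sigma>" by blast
    then show "\<exists>u. weak_slope act f u \<le> ennreal \<sigma> \<and> \<bar>f u - m\<bar> \<le> \<sigma>"
      using mlb[OF \<gamma>(1)] Rmono[OF \<gamma>(2)] \<gamma>0(2) by (intro exI[of _ u]) auto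
  qed
qed

lemma minimax_critical_value:
  fixes act :: "'g::topological_group_add \<Rightarrow> 'e::banach \<Rightarrow> 'e"
  assumes iso: "isometric_action act" and f_cont: "continuous_on UNIV f" and f_inv: "invariant_fun act f"
    and B: "compact B" "B \<noteq> {}" "invariant_set act B" and A: "A \<subseteq> B" "\<And>x. x \<in> A \<Longrightarrow> f x \<le> L"
    and "L < c" and linking: "\<And>\<gamma>. \<gamma> \<in> equivariant_maps_rel act B A \<Longrightarrow> \<exists>x\<in>B. c \<le> f (\<gamma> x)"
    and PS: "\<And>m. c \<le> m \<Longrightarrow> PS_condition act f m"
  shows "\<exists>m\<ge>c. critical_value act f m"
proof -
  obtain m where m: "c \<le> m"
    and ac: "\<And>\<sigma>. 0 < \<sigma> \<Longrightarrow> \<exists>u. weak_slope act f u \<le> ennreal \<sigma> \<and> \<bar>f u - m\<bar> \<le> \<sigma>"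
    using minimax_almost_critical[OF iso f_cont f_inv B A \<open>L < c\<close> linking] by metis
  have "\<exists>u. weak_slope act f u \<le> ennreal (1 / Suc n) \<and> \<bar>f u - m\<bar> \<le> 1 / Suc n" for n
    by (rule ac) simp
  then obtain u where u: "\<And>n. weak_slope act f (u n) \<le> ennreal (1 / Suc n)" "\<And>n. \<bar>f (u n) - m\<bar> \<le> 1 / Suc n"
    by metis
  have z: "(\<lambda>n. 1 / real (Suc n)) \<longlonglongrightarrow> 0"
    using LIMSEQ_inverse_real_of_nat by (simp add: inverse_eq_divide)
  have slope: "(\<lambda>n. weak_slope act f (u n)) \<longlonglongrightarrow> 0"
  proof (rule tendsto_sandwich[of "\<lambda>_. 0"])
    show "(\<lambda>n. ennreal (1 / Suc n)) \<longlonglongrightarrow> 0" using tendsto_ennrealI[OF z] by simp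
  qed (use u in auto)
  have val: "(\<lambda>n. f (u n)) \<longlonglongrightarrow> m"
    by (rule Lim_transform2[OF tendsto_const]) (rule Lim_null_comparison[OF _ z], use u in \<open>auto simp: abs_minus_commute\<close>)
  obtain l s where s: "strict_mono (s :: nat \<Rightarrow> nat)" "(u \<circ> s) \<longlonglongrightarrow> l"
    using PS[OF m] slope val unfolding PS_condition_def by blast
  have "weak_slope act f l = 0"
    by (rule weak_slope_eq_0_limit[OF s(2)])
      (use LIMSEQ_subseq_LIMSEQ[OF slope s(1)] in \<open>simp add: o_def\<close>)
  moreover have "f l = m"
  proof (rule LIMSEQ_unique)
    show "(\<lambda>n. f ((u \<circ> s) n)) \<longlonglongrightarrow> f l" using continuous_on_tendsto_compose[OF f_cont s(2)] by simp
    show "(\<lambda>n. f ((u \<circ> s) n)) \<longlonglongrightarrow> m" using LIMSEQ_subseq_LIMSEQ[OF val s(1)] by (simp add: o_def)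
  qed
  ultimately show ?thesis using m by (auto simp: critical_value_def)
qed


section \<open>Invariant strongly convex energies\<close>

lemma compact_group_action_bounded:
  fixes act :: "'g::topological_group_add \<Rightarrow> 'v::real_normed_vector \<Rightarrow> 'v"
  assumes lin: "linear_action act" and "compact (UNIV :: 'g set)" and "compact (sphere (0 :: 'v) 1)"
  obtains C where "0 < C" and "\<And>g v. norm (act g v) \<le> C * norm v"
proof -
  have cont: "continuous_on (UNIV \<times> sphere 0 1) (\<lambda>z. case z of (g, x) \<Rightarrow> act g x)"
    using lin continuous_on_subset[OF _ subset_UNIV] unfolding linear_action_def by blast
  have "bounded ((\<lambda>z. case z of (g, x) \<Rightarrow> act g x) ` (UNIV \<times> sphere (0 :: 'v) 1))"
    by (intro compact_imp_bounded compact_continuous_image[OF cont] compact_Times assms)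
  then obtain C where C: "0 < C" "\<And>g x. norm x = 1 \<Longrightarrow> norm (act g x) \<le> C"
    by (auto simp: bounded_pos)
  have "norm (act g v) \<le> C * norm v" for g v
  proof (cases "v = 0")
    case True
    then show ?thesis using lin linear_0 by (fastforce simp: linear_action_def)
  next
    case False
    have "linear (act g)" using lin by (simp add: linear_action_def)
    then have "norm (act g v) = norm v * norm (act g (sgn v))"
      using False by (simp add: sgn_div_norm linear_scale)
    also have "\<dots> \<le> norm v * C"
      using False by (intro mult_left_mono C) (auto simp: norm_sgn)
    finally show ?thesis by (simp add: mult.commute)
  qed
  then show ?thesis using that C(1) by blast
qed

text \<open>
  Taking the supremum over the orbit makes the squared Euclidean norm invariant. Unlike the norm
  itself, the square is strongly convex, and a supremum of functions with a common modulus of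
  convexity has the same modulus.
\<close>

definition orbit_energy :: "('g \<Rightarrow> 'v::real_normed_vector \<Rightarrow> 'v) \<Rightarrow> 'v \<Rightarrow> real" where
  "orbit_energy act v = (SUP g. (norm (act g v))\<^sup>2)"

context
  fixes act :: "'g::topological_group_add \<Rightarrow> 'v::euclidean_space \<Rightarrow> 'v" and C :: real
  assumes lin: "linear_action act" and C: "0 < C" "\<And>g v. norm (act g v) \<le> C * norm v"
begin

lemma orbit_energy_upper: "(norm (act g v))\<^sup>2 \<le> orbit_energy act v"
  unfolding orbit_energy_def
proof (rule cSUP_upper)
  show "bdd_above (range (\<lambda>g. (norm (act g v))\<^sup>2))"
    using C(2) by (intro bdd_aboveI[of _ "(C * norm v)\<^sup>2"]) (auto intro!: power_mono)
qed simp

lemma orbit_energy_least: "(\<And>g. (norm (act g v))\<^sup>2 \<le> a) \<Longrightarrow> orbit_energy act v \<le> a"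
  unfolding orbit_energy_def by (rule cSUP_least) auto

lemma orbit_energy_nonneg: "0 \<le> orbit_energy act v"
  using orbit_energy_upper[of 0 v] zero_le_power2[of "norm (act 0 v)"] by linarith

lemma orbit_energy_invariant: "orbit_energy act (act h v) = orbit_energy act v"
proof (rule antisym)
  have add: "act g (act h v) = act (g + h) v" for g h v using lin by (simp add: linear_action_def)
  show le: "orbit_energy act (act h v) \<le> orbit_energy act v" for h v
    by (rule orbit_energy_least) (simp add: add orbit_energy_upper)
  show "orbit_energy act v \<le> orbit_energy act (act h v)"
    using le[of "- h" "act h v"] by (simp add: linear_action_cancel[OF lin])
qed

lemma orbit_energy_scale: "orbit_energy act (t *\<^sub>R v) \<le> t\<^sup>2 * orbit_energy act v"
proof (rule orbit_energy_least)
  fix g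
  have "act g (t *\<^sub>R v) = t *\<^sub>R act g v" using lin by (simp add: linear_action_def linear_scale)
  then show "(norm (act g (t *\<^sub>R v)))\<^sup>2 \<le> t\<^sup>2 * orbit_energy act v"
    using mult_left_mono[OF orbit_energy_upper[of g v], of "t\<^sup>2"] by (simp add: power_mult_distrib)
qed

text \<open>
  The parallelogram law for each \<open>act g\<close>; the modulus is uniform in \<open>g\<close> because
  \<open>norm (act g (a - b))\<close> is at least \<open>norm (a - b) / C\<close>, by the bound on \<open>act (- g)\<close>.
\<close>

lemma orbit_energy_midpoint:
  "orbit_energy act ((1/2) *\<^sub>R (a + b)) \<le>
     (orbit_energy act a + orbit_energy act b) / 2 - (norm (a - b))\<^sup>2 / (4 * C\<^sup>2)"
proof (rule orbit_energy_least)
  fix g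
  have lg: "linear (act g)" using lin by (simp add: linear_action_def)
  have "norm (a - b) \<le> C * norm (act g (a - b))"
    using C(2)[of "- g" "act g (a - b)"] by (simp add: linear_action_cancel[OF lin])
  then have "(norm (a - b))\<^sup>2 \<le> (C * norm (act g (a - b)))\<^sup>2" by (rule power_mono) simp
  then have "(norm (a - b))\<^sup>2 / C\<^sup>2 \<le> (norm (act g (a - b)))\<^sup>2"
    using C(1) by (simp add: pos_divide_le_eq power_mult_distrib mult.commute)
  moreover have "(norm (act g ((1/2) *\<^sub>R (a + b))))\<^sup>2 =
      ((norm (act g a))\<^sup>2 + (norm (act g b))\<^sup>2) / 2 - (norm (act g (a - b)))\<^sup>2 / 4"
    unfolding linear_scale[OF lg] linear_add[OF lg] linear_diff[OF lg]
    by (simp add: power2_norm_eq_inner inner_simps inner_commute field_simps)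
  ultimately show "(norm (act g ((1/2) *\<^sub>R (a + b))))\<^sup>2 \<le>
      (orbit_energy act a + orbit_energy act b) / 2 - (norm (a - b))\<^sup>2 / (4 * C\<^sup>2)"
    using orbit_energy_upper[of g a] orbit_energy_upper[of g b] by (simp add: field_simps)
qed

lemma orbit_energy_continuous: "continuous_on UNIV (orbit_energy act)"
proof (rule convex_on_continuous[OF open_UNIV])
  show "convex_on UNIV (orbit_energy act)"
  proof (rule convex_onI)
    fix t a b assume t: "0 < t" "t < (1 :: real)"
    show "orbit_energy act ((1 - t) *\<^sub>R a + t *\<^sub>R b) \<le> (1 - t) * orbit_energy act a + t * orbit_energy act b"
    proof (rule orbit_energy_least)
      fix g
      have lg: "linear (act g)" using lin by (simp add: linear_action_def)
      have "norm (act g ((1 - t) *\<^sub>R a + t *\<^sub>R b)) \<le> (1 - t) * norm (act g a) + t * norm (act g b)"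
        using t norm_triangle_ineq[of "(1 - t) *\<^sub>R act g a" "t *\<^sub>R act g b"]
        by (simp add: linear_add[OF lg] linear_scale[OF lg])
      then have "(norm (act g ((1 - t) *\<^sub>R a + t *\<^sub>R b)))\<^sup>2 \<le> ((1 - t) * norm (act g a) + t * norm (act g b))\<^sup>2"
        by (rule power_mono) simp
      also have "\<dots> \<le> (1 - t) * (norm (act g a))\<^sup>2 + t * (norm (act g b))\<^sup>2"
        using convex_onD[OF convex_power2, of t "norm (act g a)" "norm (act g b)"] t by simp
      also have "\<dots> \<le> (1 - t) * orbit_energy act a + t * orbit_energy act b"
        using t by (intro add_mono mult_left_mono orbit_energy_upper) auto
      finally show "(norm (act g ((1 - t) *\<^sub>R a + t *\<^sub>R b)))\<^sup>2 \<le> \<dots>" .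
    qed
  qed simp
qed

end

text \<open>
  The midpoint inequality makes minimising sequences Cauchy in each coordinate, and compared with the
  minimum itself it gives the quadratic growth stated here, from which both uniqueness and stability of the
  minimiser follow.
\<close>

lemma strongly_convex_minimizer:
  fixes J :: "(nat \<Rightarrow> 'v::banach) \<Rightarrow> real"
  assumes "0 < \<kappa>" and nonneg: "\<And>x. 0 \<le> J x"
    and mid: "\<And>x y. J (\<lambda>i. (1/2) *\<^sub>R (x i + y i)) \<le> (J x + J y) / 2 - \<kappa> * (\<Sum>i<k. (norm (x i - y i))\<^sup>2)"
    and cont: "\<And>X x. (\<And>i. i < k \<Longrightarrow> (\<lambda>n. X n i) \<longlonglongrightarrow> x i) \<Longrightarrow> (\<lambda>n. J (X n)) \<longlonglongrightarrow> J x"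
  obtains x where "\<And>y. J x + 2 * \<kappa> * (\<Sum>i<k. (norm (x i - y i))\<^sup>2) \<le> J y"
proof -
  define m where "m = (INF x. J x)"
  have m: "m \<le> J x" for x unfolding m_def by (rule cINF_lower[OF bdd_belowI2[of _ 0]]) (use nonneg in auto)
  have "\<exists>x. J x < m + 1 / Suc n" for n
    using cInf_lessD[of "range J" "m + 1 / Suc n"] unfolding m_def by auto
  then obtain X where X: "\<And>n. J (X n) < m + 1 / Suc n" by metis
  have z: "(\<lambda>n. 1 / real (Suc n)) \<longlonglongrightarrow> 0"
    using LIMSEQ_inverse_real_of_nat by (simp add: inverse_eq_divide)
  have "Cauchy (\<lambda>n. X n i)" if i: "i < k" for i
  proof (rule metric_CauchyI)
    fix e :: real assume e: "0 < e"
    then have "\<forall>\<^sub>F n in sequentially. 1 / real (Suc n) < \<kappa> * e\<^sup>2"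
      using \<open>0 < \<kappa>\<close> by (intro order_tendstoD(2)[OF z]) simp
    then obtain N where N: "\<And>n. N \<le> n \<Longrightarrow> 1 / real (Suc n) < \<kappa> * e\<^sup>2" by (auto simp: eventually_sequentially)
    have below: "J (X n) < m + \<kappa> * e\<^sup>2" if "N \<le> n" for n
      by (rule less_trans[OF X add_strict_left_mono[OF N[OF that]]])
    have "dist (X p i) (X q i) < e" if "N \<le> p" "N \<le> q" for p q
    proof -
      have "\<kappa> * (norm (X p i - X q i))\<^sup>2 \<le> \<kappa> * (\<Sum>i<k. (norm (X p i - X q i))\<^sup>2)"
        using i \<open>0 < \<kappa>\<close> by (intro mult_left_mono member_le_sum) auto
      also have "\<dots> \<le> (J (X p) + J (X q)) / 2 - m"
        using mid[of "X p" "X q"] m[of "\<lambda>i. (1/2) *\<^sub>R (X p i + X q i)"] by linarith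
      also have "\<dots> < \<kappa> * e\<^sup>2" using below[OF that(1)] below[OF that(2)] by (simp add: field_simps)
      finally have "(norm (X p i - X q i))\<^sup>2 < e\<^sup>2" using \<open>0 < \<kappa>\<close> by simp
      then show ?thesis using e by (simp add: dist_norm power_less_imp_less_base)
    qed
    then show "\<exists>N. \<forall>p\<ge>N. \<forall>q\<ge>N. dist (X p i) (X q i) < e" by blast
  qed
  then have "\<exists>l. (\<lambda>n. X n i) \<longlonglongrightarrow> l" if "i < k" for i
    using that by (simp add: Cauchy_convergent_iff convergent_def)
  then obtain x where "\<And>i. i < k \<Longrightarrow> (\<lambda>n. X n i) \<longlonglongrightarrow> x i" by metis
  then have Jx: "(\<lambda>n. J (X n)) \<longlonglongrightarrow> J x" by (rule cont)
  have "(\<lambda>n. m + 1 / real (Suc n)) \<longlonglongrightarrow> m + 0" by (intro tendsto_intros z)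
  then have "J x \<le> m + 0"
    by (rule LIMSEQ_le[OF Jx]) (use X less_imp_le in blast)
  then have Jm: "J x = m" using m[of x] by simp
  show ?thesis
  proof (rule that)
    fix y
    show "J x + 2 * \<kappa> * (\<Sum>i<k. (norm (x i - y i))\<^sup>2) \<le> J y"
      using mid[of x y] m[of "\<lambda>i. (1/2) *\<^sub>R (x i + y i)"] unfolding Jm by (simp add: field_simps)
  qed
qed

lemma infdist_subspace_convex:
  fixes Z :: "'e::real_normed_vector set"
  assumes Z: "subspace Z" and t: "0 \<le> t" "t \<le> 1"
  shows "infdist ((1 - t) *\<^sub>R a + t *\<^sub>R b) Z \<le> (1 - t) * infdist a Z + t * infdist b Z"
proof (rule field_le_epsilon)
  fix e :: real assume e: "0 < e"
  have ne: "Z \<noteq> {}" using subspace_0[OF Z] by blast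
  have "\<exists>z\<in>Z. dist c z < infdist c Z + e" for c
    using ne e cInf_lessD[of "dist c ` Z" "infdist c Z + e"] by (auto simp: infdist_def)
  then obtain z w where z: "z \<in> Z" "dist a z < infdist a Z + e" and w: "w \<in> Z" "dist b w < infdist b Z + e"
    by metis
  have "infdist ((1 - t) *\<^sub>R a + t *\<^sub>R b) Z \<le> dist ((1 - t) *\<^sub>R a + t *\<^sub>R b) ((1 - t) *\<^sub>R z + t *\<^sub>R w)"
    by (intro infdist_le subspace_add[OF Z] subspace_scale[OF Z] z w)
  also have "\<dots> = norm ((1 - t) *\<^sub>R (a - z) + t *\<^sub>R (b - w))" by (simp add: dist_norm algebra_simps)
  also have "\<dots> \<le> (1 - t) * dist a z + t * dist b w"
    using t norm_triangle_ineq[of "(1 - t) *\<^sub>R (a - z)" "t *\<^sub>R (b - w)"] by (simp add: dist_norm)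
  also have "\<dots> \<le> (1 - t) * (infdist a Z + e) + t * (infdist b Z + e)"
    using t z w by (intro add_mono mult_left_mono) auto
  also have "\<dots> = (1 - t) * infdist a Z + t * infdist b Z + e" by (simp add: algebra_simps)
  finally show "infdist ((1 - t) *\<^sub>R a + t *\<^sub>R b) Z \<le> \<dots>" .
qed

section \<open>An equivariant map vanishing only on a closed subspace\<close>

text \<open>
  \<open>T y\<close> minimises the functional \<open>J y\<close> below. Since \<open>J\<close> is 1-Lipschitz in \<open>y\<close>, quadratic growth
  makes \<open>T\<close> Hoelder continuous with exponent \<open>1/2\<close>. If \<open>T y = 0\<close>, compare with \<open>t\<close> times a
  vector \<open>x\<close> whose block sum brings \<open>y\<close> to within half its distance from \<open>Z\<close>: the distance falls
  linearly in \<open>t\<close> while the energy grows quadratically, which is impossible for small \<open>t\<close> unless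
  the distance is already \<open>0\<close>.
\<close>

lemma equivariant_map_zeros_in_closed_subspace:
  fixes actE :: "'g::topological_group_add \<Rightarrow> 'e::real_normed_vector \<Rightarrow> 'e"
    and actV :: "'g \<Rightarrow> 'v::euclidean_space \<Rightarrow> 'v" and \<phi> :: "nat \<Rightarrow> 'v \<Rightarrow> 'e"
  assumes isoE: "isometric_action actE" and linV: "linear_action actV"
    and C: "0 < C" "\<And>g v. norm (actV g v) \<le> C * norm v"
    and \<phi>: "\<And>i. linear (\<phi> i)" "\<And>i. continuous_on UNIV (\<phi> i)"
    and \<phi>_equiv: "\<And>i g v. \<phi> i (actV g v) = actE g (\<phi> i v)"
    and Z: "subspace Z" "closed Z" "invariant_set actE Z"
    and dense: "\<And>y e. 0 < e \<Longrightarrow> \<exists>x. infdist (y - (\<Sum>i<k. \<phi> i (x i))) Z < e"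
  obtains T :: "'e \<Rightarrow> nat \<Rightarrow> 'v" where "\<And>i. i < k \<Longrightarrow> continuous_on UNIV (\<lambda>y. T y i)"
    and "\<And>g y i. i < k \<Longrightarrow> T (actE g y) i = actV g (T y i)"
    and "\<And>y. (\<And>i. i < k \<Longrightarrow> T y i = 0) \<Longrightarrow> y \<in> Z"
proof -
  let ?q = "orbit_energy actV"
  note q = orbit_energy_nonneg[OF linV C] orbit_energy_invariant[OF linV C]
    orbit_energy_midpoint[OF linV C] orbit_energy_scale[OF linV C]
  define \<Phi> where "\<Phi> x = (\<Sum>i<k. \<phi> i (x i))" for x
  define J where "J y x = infdist (y - \<Phi> x) Z + (\<Sum>i<k. ?q (x i))" for y x
  define \<kappa> where "\<kappa> = 1 / (4 * C\<^sup>2)"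
  have \<kappa>: "0 < \<kappa>" using C(1) by (simp add: \<kappa>_def)
  have \<Phi>_affine: "y - \<Phi> (\<lambda>i. (1 - t) *\<^sub>R x i + t *\<^sub>R x' i) = (1 - t) *\<^sub>R (y - \<Phi> x) + t *\<^sub>R (y - \<Phi> x')"
    for y t x x'
  proof -
    have "\<Phi> (\<lambda>i. (1 - t) *\<^sub>R x i + t *\<^sub>R x' i) = (1 - t) *\<^sub>R \<Phi> x + t *\<^sub>R \<Phi> x'"
      by (simp only: \<Phi>_def linear_add[OF \<phi>(1)] linear_scale[OF \<phi>(1)] sum.distrib scaleR_sum_right)
    then show ?thesis by (simp add: algebra_simps)
  qed
  have "\<exists>x. \<forall>x'. J y x + 2 * \<kappa> * (\<Sum>i<k. (norm (x i - x' i))\<^sup>2) \<le> J y x'" for y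
  proof (rule strongly_convex_minimizer[of \<kappa> "J y" k, OF \<kappa>])
    show "0 \<le> J y x" for x unfolding J_def by (intro add_nonneg_nonneg sum_nonneg infdist_nonneg q(1))
    show "J y (\<lambda>i. (1/2) *\<^sub>R (x i + x' i)) \<le> (J y x + J y x') / 2 - \<kappa> * (\<Sum>i<k. (norm (x i - x' i))\<^sup>2)"
      for x x'
    proof -
      have "infdist (y - \<Phi> (\<lambda>i. (1/2) *\<^sub>R (x i + x' i))) Z \<le> (infdist (y - \<Phi> x) Z + infdist (y - \<Phi> x') Z) / 2"
        using infdist_subspace_convex[OF Z(1), of "1/2" "y - \<Phi> x" "y - \<Phi> x'"] \<Phi>_affine[of y "1/2" x x']
        by (simp add: scaleR_add_right)
      moreover have "(\<Sum>i<k. ?q ((1/2) *\<^sub>R (x i + x' i))) \<le>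
          (\<Sum>i<k. (?q (x i) + ?q (x' i)) / 2 - \<kappa> * (norm (x i - x' i))\<^sup>2)"
        by (rule sum_mono) (use q(3) in \<open>simp add: \<kappa>_def\<close>)
      moreover have "\<dots> = ((\<Sum>i<k. ?q (x i)) + (\<Sum>i<k. ?q (x' i))) / 2 - \<kappa> * (\<Sum>i<k. (norm (x i - x' i))\<^sup>2)"
        by (simp add: sum_subtractf sum.distrib sum_distrib_left sum_divide_distrib[symmetric])
      ultimately show ?thesis unfolding J_def by (simp add: field_simps)
    qed
    show "(\<lambda>n. J y (X n)) \<longlonglongrightarrow> J y x" if X: "\<And>i. i < k \<Longrightarrow> (\<lambda>n. X n i) \<longlonglongrightarrow> x i" for X x
      unfolding J_def \<Phi>_def
      by (intro tendsto_intros tendsto_infdist)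
        (auto intro!: continuous_on_tendsto_compose[OF \<phi>(2)] X
           continuous_on_tendsto_compose[OF orbit_energy_continuous[OF linV C]])
  qed blast
  then obtain T where T: "\<And>y x. J y (T y) + 2 * \<kappa> * (\<Sum>i<k. (norm (T y i - x i))\<^sup>2) \<le> J y x"
    by metis
  have near: "2 * \<kappa> * (norm (T y i - x i))\<^sup>2 \<le> J y x - J y (T y)" if "i < k" for y x i
  proof -
    have "2 * \<kappa> * (norm (T y i - x i))\<^sup>2 \<le> 2 * \<kappa> * (\<Sum>i<k. (norm (T y i - x i))\<^sup>2)"
      using that \<kappa> by (intro mult_left_mono member_le_sum) auto
    then show ?thesis using T[of y x] by linarith
  qed
  have minimal: "J y (T y) \<le> J y x" for y x
  proof -
    have "0 \<le> 2 * \<kappa> * (\<Sum>i<k. (norm (T y i - x i))\<^sup>2)" using \<kappa> by (simp add: sum_nonneg)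
    then show ?thesis using T[of y x] by linarith
  qed
  have JLip: "J y x \<le> J y' x + dist y y'" for y y' x
    using infdist_triangle[of "y - \<Phi> x" Z "y' - \<Phi> x"] by (simp add: J_def dist_norm)
  show ?thesis
  proof (rule that)
    fix i assume i: "i < k"
    show "continuous_on UNIV (\<lambda>y. T y i)"
      unfolding continuous_on_iff
    proof (intro ballI allI impI)
      fix y and e :: real assume e: "0 < e"
      have "dist (T y' i) (T y i) < e" if d: "dist y' y < \<kappa> * e\<^sup>2" for y'
      proof -
        have "2 * \<kappa> * (norm (T y i - T y' i))\<^sup>2 \<le> J y (T y') - J y (T y)" by (rule near[OF i])
        also have "\<dots> \<le> 2 * dist y y'"
          using JLip[of y "T y'" y'] JLip[of y' "T y" y] minimal[of y' "T y"] by (simp add: dist_commute)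
        also have "\<dots> < 2 * \<kappa> * e\<^sup>2" using d by (simp add: dist_commute)
        finally have "(norm (T y i - T y' i))\<^sup>2 < e\<^sup>2" using \<kappa> by simp
        then show ?thesis using e by (simp add: dist_norm norm_minus_commute power_less_imp_less_base)
      qed
      then show "\<exists>d>0. \<forall>y'\<in>UNIV. dist y' y < d \<longrightarrow> dist (T y' i) (T y i) < e"
        using \<kappa> e by (intro exI[of _ "\<kappa> * e\<^sup>2"]) auto
    qed
  next
    fix g y i assume i: "i < k"
    have linE: "linear (actE g)" for g by (rule isometric_action_linear[OF isoE])
    have J_inv: "J (actE g y) (\<lambda>i. actV g (x i)) = J y x" for g y x
    proof -
      have "actE g y - \<Phi> (\<lambda>i. actV g (x i)) = actE g (y - \<Phi> x)"
        by (simp add: \<Phi>_def \<phi>_equiv linear_diff[OF linE] linear_sum[OF linE])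
      then show ?thesis by (simp add: J_def infdist_invariant[OF isoE Z(3)] q(2))
    qed
    \<comment> \<open>The translate of the minimiser at \<open>y\<close> minimises at \<open>actE g y\<close>; uniqueness identifies the two.\<close>
    have "J (actE g y) (T (actE g y)) = J y (\<lambda>i. actV (- g) (T (actE g y) i))"
      using J_inv[of "- g" "actE g y" "T (actE g y)"] by (simp add: isometric_action_cancel[OF isoE])
    then have "J (actE g y) (\<lambda>i. actV g (T y i)) \<le> J (actE g y) (T (actE g y))"
      using minimal[of y "\<lambda>i. actV (- g) (T (actE g y) i)"] by (simp add: J_inv)
    then have "2 * \<kappa> * (norm (T (actE g y) i - actV g (T y i)))\<^sup>2 \<le> 0"
      using near[OF i, of "actE g y" "\<lambda>i. actV g (T y i)"] by linarith
    then show "T (actE g y) i = actV g (T y i)"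
      using \<kappa> by (simp add: mult_le_0_iff)
  next
    fix y assume T0: "\<And>i. i < k \<Longrightarrow> T y i = 0"
    have z0: "?q 0 = 0" using q(4)[of 0 0] q(1)[of 0] by simp
    have J0: "J y (T y) = infdist y Z"
      by (simp add: J_def \<Phi>_def T0 z0 linear_0[OF \<phi>(1)])
    show "y \<in> Z"
    proof (rule ccontr)
      assume "y \<notin> Z"
      moreover have ne: "Z \<noteq> {}" using subspace_0[OF Z(1)] by blast
      ultimately have d: "0 < infdist y Z"
        using in_closed_iff_infdist_zero[OF Z(2) ne, of y] infdist_nonneg[of y Z] by linarith
      define d where "d = infdist y Z"
      obtain x where x: "infdist (y - \<Phi> x) Z < d / 2"
        using dense[of "d / 2" y] d by (auto simp: \<Phi>_def d_def)
      define S where "S = (\<Sum>i<k. ?q (x i))"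
      have S: "0 \<le> S" unfolding S_def by (intro sum_nonneg q(1))
      define t where "t = min 1 (d / (4 * (S + 1)))"
      have t: "0 < t" "t \<le> 1" "t * S < d / 2"
      proof -
        show "0 < t" "t \<le> 1" using d S by (auto simp: t_def d_def)
        have "t * S \<le> d / (4 * (S + 1)) * S" using S by (intro mult_right_mono) (auto simp: t_def)
        also have "\<dots> < d / 2" using d S by (simp add: field_simps d_def add_pos_nonneg)
        finally show "t * S < d / 2" .
      qed
      have tx: "\<Phi> (\<lambda>i. (1 - t) *\<^sub>R 0 + t *\<^sub>R x i) = \<Phi> (\<lambda>i. t *\<^sub>R x i)" "\<Phi> (\<lambda>i. 0) = 0"
        by (simp_all add: \<Phi>_def linear_0[OF \<phi>(1)])
      have "infdist (y - \<Phi> (\<lambda>i. t *\<^sub>R x i)) Z \<le> (1 - t) * d + t * infdist (y - \<Phi> x) Z"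
        using infdist_subspace_convex[OF Z(1), of t y "y - \<Phi> x"] \<Phi>_affine[of y t "\<lambda>i. 0" x] t tx
        by (simp add: d_def)
      also have "\<dots> \<le> (1 - t) * d + t * (d / 2)" using x t by simp
      finally have 1: "infdist (y - \<Phi> (\<lambda>i. t *\<^sub>R x i)) Z \<le> d - t * (d / 2)" by (simp add: algebra_simps)
      have "(\<Sum>i<k. ?q (t *\<^sub>R x i)) \<le> (\<Sum>i<k. t\<^sup>2 * ?q (x i))" by (intro sum_mono q(4))
      then have 2: "(\<Sum>i<k. ?q (t *\<^sub>R x i)) \<le> t * (t * S)"
        by (simp add: S_def sum_distrib_left power2_eq_square mult.assoc)
      have "d \<le> d - t * (d / 2) + t * (t * S)"
        using minimal[of y "\<lambda>i. t *\<^sub>R x i"] 1 2 J0 unfolding J_def[of y "\<lambda>i. t *\<^sub>R x i"] d_def by linarith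
      moreover have "t * (t * S) < t * (d / 2)" using t by simp
      ultimately show False by simp
    qed
  qed
qed


section \<open>Linking in powers of an admissible representation\<close>

text \<open>
  The coordinates from \<open>n\<close> on are constant on \<open>power_top n\<close>, so the inclusion into the type of all
  sequences with its product topology is continuous. This transfers continuity proved on the type.
\<close>

lemma continuous_map_power_top:
  fixes g :: "(nat \<Rightarrow> 'v::topological_space) \<Rightarrow> 'b::topological_space"
  assumes "continuous_on UNIV g"
  shows "continuous_map (power_top n) euclidean g"
proof -
  have "continuous_map (power_top n) (product_topology (\<lambda>_. euclidean) UNIV) (\<lambda>x :: nat \<Rightarrow> 'v. x)"
    unfolding continuous_map_componentwise_UNIV
  proof
    fix i
    show "continuous_map (power_top n) euclidean (\<lambda>x :: nat \<Rightarrow> 'v. x i)"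
    proof (cases "i < n")
      case True
      then show ?thesis unfolding power_top_def by (intro continuous_map_product_projection) auto
    next
      case False
      have "continuous_map (power_top n) euclidean (\<lambda>x :: nat \<Rightarrow> 'v. undefined :: 'v)" by simp
      then show ?thesis
        by (rule continuous_map_eq) (use False in \<open>auto simp: power_top_def PiE_def extensional_def\<close>)
    qed
  qed
  then have "continuous_map (power_top n) euclidean (\<lambda>x :: nat \<Rightarrow> 'v. x)"
    by (simp add: euclidean_product_topology)
  from continuous_map_compose[OF this, of euclidean g] assms show ?thesis by (simp add: o_def)
qed

lemma continuous_on_coordinate: "continuous_on S (\<lambda>x :: nat \<Rightarrow> 'v::topological_space. x i)"
  using continuous_on_product_then_coordinatewise[OF continuous_on_id] .

lemma topspace_power_top: "topspace (power_top n) = extensional {..<n}"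
  by (auto simp: power_top_def PiE_def)

definition block_sum :: "(nat \<Rightarrow> 'v \<Rightarrow> 'e::real_normed_vector) \<Rightarrow> nat \<Rightarrow> (nat \<Rightarrow> 'v) \<Rightarrow> 'e" where
  "block_sum \<phi> n x = (\<Sum>i<n. \<phi> i (x i))"

lemma block_sum_restrict: "block_sum \<phi> n (restrict x {..<n}) = block_sum \<phi> n x"
  by (simp add: block_sum_def)

lemma continuous_block_sum:
  fixes \<phi> :: "nat \<Rightarrow> 'v::topological_space \<Rightarrow> 'e::real_normed_vector"
  assumes "\<And>i. continuous_on UNIV (\<phi> i)"
  shows "continuous_on UNIV (block_sum \<phi> n)"
  unfolding block_sum_def
  by (intro continuous_on_sum continuous_on_compose2[OF assms continuous_on_coordinate]) auto

text \<open>
  Compactness of the unit sphere of \<open>V\<^sup>n\<close> for the maximum norm, and scaling.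
\<close>

lemma block_sum_bounded_below:
  fixes \<phi> :: "nat \<Rightarrow> 'v::euclidean_space \<Rightarrow> 'e::real_normed_vector"
  assumes \<phi>: "\<And>i. linear (\<phi> i)" "\<And>i. continuous_on UNIV (\<phi> i)"
    and inj: "\<And>x i. block_sum \<phi> n x = 0 \<Longrightarrow> i < n \<Longrightarrow> x i = 0"
  obtains c where "0 < c" and "\<And>x i. i < n \<Longrightarrow> norm (x i) \<le> c * norm (block_sum \<phi> n x)"
proof -
  define S :: "(nat \<Rightarrow> 'v) set" where "S = PiE {..<n} (\<lambda>_. cball 0 1) \<inter> (\<Union>i<n. {x \<in> topspace (power_top n). norm (x i) \<in> {1}})"
  have cb: "compactin (power_top n) (PiE {..<n} (\<lambda>_. cball (0 :: 'v) 1))"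
    unfolding power_top_def compactin_PiE by simp
  have "compactin (power_top n) S"
    unfolding S_def
  proof (intro compact_Int_closedin[OF cb] closedin_Union)
    fix T assume "T \<in> (\<lambda>i. {x :: nat \<Rightarrow> 'v. x \<in> topspace (power_top n) \<and> norm (x i) \<in> {1}}) ` {..<n}"
    moreover have "continuous_map (power_top n) euclidean (\<lambda>x :: nat \<Rightarrow> 'v. norm (x i))" for i
      by (intro continuous_map_power_top continuous_on_norm continuous_on_coordinate)
    ultimately show "closedin (power_top n) T"
      using closedin_continuous_map_preimage[of "power_top n" euclidean _ "{1 :: real}"] by auto
  qed auto
  moreover have "continuous_map (power_top n) euclidean (\<lambda>x. norm (block_sum \<phi> n x))"
    by (intro continuous_map_power_top continuous_on_norm continuous_block_sum \<phi>)
  ultimately have "compactin euclidean ((\<lambda>x. norm (block_sum \<phi> n x)) ` S)" by (rule image_compactin)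
  then have cpt: "compact ((\<lambda>x. norm (block_sum \<phi> n x)) ` S)" by simp
  have pos: "0 < norm (block_sum \<phi> n x)" if "x \<in> S" for x
  proof -
    from that obtain i where "i < n" "norm (x i) = 1" by (auto simp: S_def)
    then show ?thesis using inj[of x i] by auto
  qed
  obtain m where m: "0 < m" "\<And>x. x \<in> S \<Longrightarrow> m \<le> norm (block_sum \<phi> n x)"
  proof (cases "S = {}")
    case True
    then show ?thesis using that[of 1] by simp
  next
    case False
    then obtain x where "x \<in> S" "\<And>y. y \<in> S \<Longrightarrow> norm (block_sum \<phi> n x) \<le> norm (block_sum \<phi> n y)"
      using compact_attains_inf[OF cpt] by auto
    then show ?thesis using that pos by blast
  qed
  show ?thesis
  proof (rule that[of "1 / m"])
    show "0 < 1 / m" using m by simp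
    fix x :: "nat \<Rightarrow> 'v" and i assume i: "i < n"
    define a where "a = Max ((\<lambda>j. norm (x j)) ` {..<n})"
    have le: "norm (x j) \<le> a" if "j < n" for j unfolding a_def using that by (intro Max_ge) auto
    have "a \<in> (\<lambda>j. norm (x j)) ` {..<n}" unfolding a_def using i by (intro Max_in) auto
    then obtain j where j: "j < n" "norm (x j) = a" by auto
    have "a \<le> 1 / m * norm (block_sum \<phi> n x)"
    proof (cases "a = 0")
      case False
      then have a: "0 < a" using j by auto
      define y where "y = (\<lambda>l\<in>{..<n}. (1 / a) *\<^sub>R x l)"
      have "y \<in> S" using a le j by (auto simp: S_def y_def topspace_power_top)
      then have "m \<le> norm (block_sum \<phi> n y)" by (rule m)
      also have "block_sum \<phi> n y = (1 / a) *\<^sub>R block_sum \<phi> n x"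
        unfolding y_def block_sum_restrict by (simp add: block_sum_def linear_scale[OF \<phi>(1)] scaleR_sum_right)
      finally show ?thesis using a m by (simp add: field_simps)
    qed (use m in simp)
    then show "norm (x i) \<le> 1 / m * norm (block_sum \<phi> n x)" using le[OF i] by linarith
  qed
qed

lemma block_sum_diag_action:
  fixes actE :: "'g::topological_group_add \<Rightarrow> 'e::real_normed_vector \<Rightarrow> 'e"
  assumes lin: "\<And>g. linear (actE g)" and \<phi>_equiv: "\<And>i g v. \<phi> i (actV g v) = actE g (\<phi> i v)"
  shows "block_sum \<phi> n (diag_action n actV g x) = actE g (block_sum \<phi> n x)"
  unfolding diag_action_def block_sum_restrict by (simp add: block_sum_def \<phi>_equiv linear_sum[OF lin])

definition block_ball :: "(nat \<Rightarrow> 'v \<Rightarrow> 'e::real_normed_vector) \<Rightarrow> nat \<Rightarrow> real \<Rightarrow> 'e set" where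
  "block_ball \<phi> n \<rho> = {y \<in> range (block_sum \<phi> n). norm y \<le> \<rho>}"

lemma invariant_block_ball:
  fixes actE :: "'g::topological_group_add \<Rightarrow> 'e::real_normed_vector \<Rightarrow> 'e"
  assumes iso: "isometric_action actE" and \<phi>_equiv: "\<And>i g v. \<phi> i (actV g v) = actE g (\<phi> i v)"
  shows "invariant_set actE (block_ball \<phi> n \<rho>)"
proof (rule invariant_setI[OF isometric_imp_linear_action[OF iso]])
  fix g y assume "y \<in> block_ball \<phi> n \<rho>"
  then obtain x where x: "y = block_sum \<phi> n x" "norm y \<le> \<rho>" by (auto simp: block_ball_def)
  have "actE g y = block_sum \<phi> n (diag_action n actV g x)"
    using block_sum_diag_action[of actE \<phi> actV n g x] isometric_action_linear[OF iso] \<phi>_equiv x by simp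
  moreover have "norm (actE g y) = norm y" using iso by (simp add: isometric_action_def)
  ultimately show "actE g y \<in> block_ball \<phi> n \<rho>"
    using x(2) by (auto simp: block_ball_def simp del: range_eqI)
qed

lemma compact_block_ball:
  fixes \<phi> :: "nat \<Rightarrow> 'v::euclidean_space \<Rightarrow> 'e::real_normed_vector"
  assumes \<phi>: "\<And>i. continuous_on UNIV (\<phi> i)"
    and c: "0 < c" "\<And>x i. i < n \<Longrightarrow> norm (x i) \<le> c * norm (block_sum \<phi> n x)"
  shows "compact (block_ball \<phi> n \<rho>)"
proof -
  let ?P = "power_top n :: (nat \<Rightarrow> 'v) topology"
  define K :: "(nat \<Rightarrow> 'v) set"
    where "K = PiE {..<n} (\<lambda>_. cball 0 (c * \<rho>)) \<inter> {x \<in> topspace ?P. block_sum \<phi> n x \<in> cball 0 \<rho>}"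
  have cont: "continuous_map ?P euclidean (block_sum \<phi> n)"
    by (intro continuous_map_power_top continuous_block_sum \<phi>)
  have "compactin ?P (PiE {..<n} (\<lambda>_. cball (0 :: 'v) (c * \<rho>)))"
    unfolding power_top_def compactin_PiE by simp
  then have "compactin ?P K"
    unfolding K_def by (rule compact_Int_closedin) (intro closedin_continuous_map_preimage[OF cont], simp)
  then have "compact (block_sum \<phi> n ` K)"
    using image_compactin[OF _ cont] by simp
  also have "block_sum \<phi> n ` K = block_ball \<phi> n \<rho>"
  proof (intro equalityI subsetI)
    fix y assume "y \<in> block_ball \<phi> n \<rho>"
    then obtain x where x: "y = block_sum \<phi> n x" "norm y \<le> \<rho>" by (auto simp: block_ball_def)
    let ?x = "restrict x {..<n}"
    have "c * norm y \<le> c * \<rho>" using x c(1) by simp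
    then have "norm (x i) \<le> c * \<rho>" if "i < n" for i
      using c(2)[OF that, of x] x(1) by simp
    then have "?x \<in> K" using x by (auto simp: K_def topspace_power_top block_sum_restrict)
    then show "y \<in> block_sum \<phi> n ` K" using x block_sum_restrict by (metis imageI)
  qed (auto simp: K_def block_ball_def)
  finally show ?thesis .
qed

text \<open>
  Admissibility is applied to the set \<open>U\<close> of those \<open>x\<close> in \<open>V\<^bsup>k+1\<^esup>\<close> whose block sum has norm
  below \<open>\<rho>\<close> and is sent by \<open>\<gamma>\<close> into the open ball of radius \<open>r\<close>. No frontier point of \<open>U\<close> lies
  over the sphere of radius \<open>\<rho>\<close>, because \<open>\<gamma>\<close> is the identity there and \<open>r < \<rho>\<close>; so on the frontier the
  value of \<open>\<gamma>\<close> has norm exactly \<open>r\<close>, and a zero of \<open>T \<circ> \<gamma>\<close> puts that value into \<open>Z\<close>.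
\<close>

lemma admissible_linking:
  fixes actE :: "'g::topological_group_add \<Rightarrow> 'e::real_normed_vector \<Rightarrow> 'e"
    and actV :: "'g \<Rightarrow> 'v::euclidean_space \<Rightarrow> 'v" and \<phi> :: "nat \<Rightarrow> 'v \<Rightarrow> 'e"
  assumes isoE: "isometric_action actE" and linV: "linear_action actV" and adm: "admissible actV"
    and \<phi>: "\<And>i. linear (\<phi> i)" "\<And>i. continuous_on UNIV (\<phi> i)"
    and \<phi>_equiv: "\<And>i g v. \<phi> i (actV g v) = actE g (\<phi> i v)"
    and c: "0 < c" "\<And>x i. i < Suc k \<Longrightarrow> norm (x i) \<le> c * norm (block_sum \<phi> (Suc k) x)"
    and "1 \<le> k" and T: "\<And>i. i < k \<Longrightarrow> continuous_on UNIV (\<lambda>y. T y i)"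
      "\<And>g y i. i < k \<Longrightarrow> T (actE g y) i = actV g (T y i)"
      "\<And>y. (\<And>i. i < k \<Longrightarrow> T y i = 0) \<Longrightarrow> y \<in> Z"
    and r: "0 < r" "r < \<rho>"
    and \<gamma>: "\<gamma> \<in> equivariant_maps_rel actE (block_ball \<phi> (Suc k) \<rho>)
              {y \<in> block_ball \<phi> (Suc k) \<rho>. y = 0 \<or> norm y = \<rho>}"
  obtains y where "y \<in> block_ball \<phi> (Suc k) \<rho>" and "\<gamma> y \<in> Z" and "norm (\<gamma> y) = r"
proof -
  let ?n = "Suc k" and ?B = "block_ball \<phi> (Suc k) \<rho>"
  let ?P = "power_top (Suc k) :: (nat \<Rightarrow> 'v) topology" and ?\<Phi> = "block_sum \<phi> (Suc k)"
  have \<gamma>_cont: "continuous_on ?B \<gamma>" and \<gamma>_equiv: "equivariant_on ?B actE actE \<gamma>"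
    and \<gamma>_fix: "\<And>y. y \<in> ?B \<Longrightarrow> y = 0 \<or> norm y = \<rho> \<Longrightarrow> \<gamma> y = y"
    using \<gamma> by (auto simp: equivariant_maps_rel_def)
  have linE: "linear (actE g)" and normE: "norm (actE g y) = norm y" for g y
    using isoE by (auto simp: isometric_action_def linear_action_def)
  have \<Phi>_diag: "?\<Phi> (diag_action ?n actV g x) = actE g (?\<Phi> x)" for g x
    using block_sum_diag_action[of actE \<phi> actV ?n g x] linE \<phi>_equiv by simp
  have \<Phi>_cont: "continuous_map ?P euclidean ?\<Phi>"
    by (intro continuous_map_power_top continuous_block_sum \<phi>)
  define D where "D = {x \<in> topspace ?P. ?\<Phi> x \<in> cball 0 \<rho>}"
  have D_closed: "closedin ?P D" unfolding D_def by (intro closedin_continuous_map_preimage[OF \<Phi>_cont]) simp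
  have D_top: "topspace (subtopology ?P D) = D" by (auto simp: D_def)
  have D_ball: "?\<Phi> x \<in> ?B" if "x \<in> D" for x using that by (auto simp: D_def block_ball_def)
  define h where "h = \<gamma> \<circ> ?\<Phi>"
  have h_cont: "continuous_map (subtopology ?P D) euclidean h"
    unfolding h_def
  proof (rule continuous_map_compose)
    show "continuous_map (subtopology ?P D) (top_of_set ?B) ?\<Phi>"
      using \<Phi>_cont D_ball by (auto simp: continuous_map_in_subtopology continuous_map_from_subtopology D_top)
    show "continuous_map (top_of_set ?B) euclidean \<gamma>" using \<gamma>_cont by simp
  qed
  have h_diag: "h (diag_action ?n actV g x) = actE g (h x)" if "x \<in> D" for g x
    using \<gamma>_equiv D_ball[OF that] by (simp add: h_def \<Phi>_diag equivariant_on_def)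
  define U where "U = {x \<in> topspace ?P. norm (?\<Phi> x) < \<rho> \<and> norm (h x) < r}"
  have UD: "U \<subseteq> D" by (auto simp: U_def D_def)
  have U_open: "openin ?P U"
  proof -
    define D' where "D' = {x \<in> topspace ?P. ?\<Phi> x \<in> ball 0 \<rho>}"
    have D': "openin ?P D'" unfolding D'_def by (intro openin_continuous_map_preimage[OF \<Phi>_cont]) simp
    have sub: "D' \<subseteq> D" by (auto simp: D_def D'_def)
    have "continuous_map (subtopology ?P D') euclidean h"
      using continuous_map_from_subtopology_mono[OF h_cont sub] .
    then have "openin (subtopology ?P D') {x \<in> topspace (subtopology ?P D'). h x \<in> ball 0 r}"
      by (rule openin_continuous_map_preimage) simp
    also have "{x \<in> topspace (subtopology ?P D'). h x \<in> ball 0 r} = U" by (auto simp: U_def D'_def)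
    finally show ?thesis using D' by (rule openin_trans_full)
  qed
  have frontier: "x \<in> D" "norm (h x) = r" if x: "x \<in> ?P frontier_of U" for x
  proof -
    let ?K = "{x \<in> topspace (subtopology ?P D). h x \<in> cball 0 r}"
    have "closedin (subtopology ?P D) ?K" by (rule closedin_continuous_map_preimage[OF h_cont]) simp
    then have "closedin ?P ?K" using D_closed by (rule closedin_trans_full)
    moreover have "U \<subseteq> ?K" unfolding D_top using UD by (auto simp: U_def)
    ultimately have "?P closure_of U \<subseteq> ?K" by (intro closure_of_minimal)
    moreover have "x \<in> ?P closure_of U" "x \<notin> U"
      using x U_open by (auto simp: frontier_of_def interior_of_openin)
    ultimately show xD: "x \<in> D" and "norm (h x) = r"
      unfolding D_top using \<gamma>_fix[OF D_ball[of x]] r by (auto simp: U_def D_def h_def)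
  qed
  have "invariant_set (diag_action ?n actV) U"
    unfolding invariant_set_def
  proof (intro allI equalityI subsetI)
    have closed: "diag_action ?n actV g x \<in> U" if "x \<in> U" for g x
      using that UD by (auto simp: U_def h_diag \<Phi>_diag normE topspace_power_top) (auto simp: diag_action_def)
    show "y \<in> U" if "y \<in> diag_action ?n actV g ` U" for g y using that closed by auto
    fix g x assume x: "x \<in> U"
    have "diag_action ?n actV g (diag_action ?n actV (- g) x) = restrict x {..<?n}"
      by (auto simp: diag_action_def linear_action_cancel[OF linV])
    also have "\<dots> = x" using x by (auto simp: U_def topspace_power_top extensional_restrict)
    finally show "x \<in> diag_action ?n actV g ` U" using closed[OF x, of "- g"] by (metis imageI)
  qed
  moreover have "power_zero ?n \<in> U"
  proof -
    have "?\<Phi> (power_zero ?n) = 0"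
      unfolding power_zero_def block_sum_restrict by (simp add: block_sum_def linear_0[OF \<phi>(1)])
    moreover have "0 \<in> ?B" using calculation r by (auto simp: block_ball_def image_iff intro: exI[of _ "power_zero ?n"])
    ultimately show ?thesis using r \<gamma>_fix[of 0] by (auto simp: U_def h_def topspace_power_top power_zero_def)
  qed
  moreover have "\<exists>b. \<forall>x\<in>U. \<forall>i<?n. norm (x i) \<le> b"
  proof (intro exI ballI allI impI)
    fix x i assume "x \<in> U" "i < ?n"
    then have "norm (x i) \<le> c * norm (?\<Phi> x)" "c * norm (?\<Phi> x) \<le> c * \<rho>"
      using c by (auto simp: U_def)
    then show "norm (x i) \<le> c * \<rho>" by linarith
  qed
  moreover define H where "H x = (\<lambda>i\<in>{..<k}. T (h x) i)" for x
  have "continuous_map (subtopology ?P (?P frontier_of U)) (power_top k) H"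
    unfolding power_top_def[of k] continuous_map_componentwise
  proof (intro conjI ballI)
    fix i assume i: "i \<in> {..<k}"
    have "continuous_map (subtopology ?P (?P frontier_of U)) euclidean h"
      by (rule continuous_map_from_subtopology_mono[OF h_cont]) (use frontier in auto)
    from continuous_map_compose[OF this, of euclidean "\<lambda>y. T y i"] T(1)[of i] i
    show "continuous_map (subtopology ?P (?P frontier_of U)) euclidean (\<lambda>x. H x i)"
      by (simp add: H_def o_def)
  qed (auto simp: H_def)
  moreover have "equivariant_on (?P frontier_of U) (diag_action ?n actV) (diag_action k actV) H"
    unfolding equivariant_on_def using frontier
    by (auto simp: H_def diag_action_def[of k] h_diag T(2))
  ultimately obtain x where x: "x \<in> ?P frontier_of U" "H x = power_zero k"
    using adm[unfolded admissible_def, rule_format, of ?n U H] U_open \<open>1 \<le> k\<close> by auto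
  have "T (h x) i = 0" if "i < k" for i
    using fun_cong[OF x(2), of i] that by (simp add: H_def power_zero_def)
  then have "h x \<in> Z" by (rule T(3))
  then show ?thesis
    using that[OF D_ball[OF frontier(1)[OF x(1)]]] frontier(2)[OF x(1)] by (simp add: h_def)
qed

section \<open>The fountain theorem\<close>

lemma span_blocks:
  fixes \<phi> :: "nat \<Rightarrow> 'v::real_vector \<Rightarrow> 'e::real_normed_vector"
  assumes \<phi>: "\<And>i. linear (\<phi> i)" "\<And>i. range (\<phi> i) = F i"
  shows "span (\<Union>i\<in>{..<n}. F i) = range (block_sum \<phi> n)"
proof (intro equalityI span_minimal subsetI)
  show "subspace (range (block_sum \<phi> n))"
  proof (rule subspaceI)
    have "block_sum \<phi> n (\<lambda>_. 0) = 0" by (simp add: block_sum_def linear_0[OF \<phi>(1)])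
    then show "0 \<in> range (block_sum \<phi> n)" by (metis rangeI)
  next
    fix a b assume "a \<in> range (block_sum \<phi> n)" "b \<in> range (block_sum \<phi> n)"
    then obtain x y where "a = block_sum \<phi> n x" "b = block_sum \<phi> n y" by blast
    then have "a + b = block_sum \<phi> n (\<lambda>i. x i + y i)"
      by (simp add: block_sum_def linear_add[OF \<phi>(1)] sum.distrib)
    then show "a + b \<in> range (block_sum \<phi> n)" by simp
  next
    fix t :: real and a assume "a \<in> range (block_sum \<phi> n)"
    then obtain x where "a = block_sum \<phi> n x" by blast
    then have "t *\<^sub>R a = block_sum \<phi> n (\<lambda>i. t *\<^sub>R x i)"
      by (simp add: block_sum_def linear_scale[OF \<phi>(1)] scaleR_sum_right)
    then show "t *\<^sub>R a \<in> range (block_sum \<phi> n)" by simp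
  qed
next
  fix a assume "a \<in> (\<Union>i\<in>{..<n}. F i)"
  then obtain i u where i: "i < n" "a = \<phi> i u" using \<phi>(2) by blast
  have "block_sum \<phi> n (\<lambda>j. if j = i then u else 0) = (\<Sum>j<n. if j = i then \<phi> i u else 0)"
    unfolding block_sum_def by (intro sum.cong) (auto simp: linear_0[OF \<phi>(1)])
  then have "a = block_sum \<phi> n (\<lambda>j. if j = i then u else 0)" using i by simp
  then show "a \<in> range (block_sum \<phi> n)" by simp
next
  fix a assume "a \<in> range (block_sum \<phi> n)"
  then obtain x where "a = (\<Sum>i<n. \<phi> i (x i))" by (auto simp: block_sum_def)
  moreover have "\<phi> i (x i) \<in> span (\<Union>i\<in>{..<n}. F i)" if "i < n" for i
    using \<phi>(2)[of i] that by (intro span_base) auto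
  ultimately show "a \<in> span (\<Union>i\<in>{..<n}. F i)" by (auto intro: span_sum)
qed

lemma subspace_closure:
  fixes S :: "'e::real_normed_vector set"
  assumes S: "subspace S"
  shows "subspace (closure S)"
proof (rule subspaceI)
  show "0 \<in> closure S" using subspace_0[OF S] closure_subset by blast
next
  fix x y assume "x \<in> closure S" "y \<in> closure S"
  then obtain a b where "\<And>n. a n \<in> S" "a \<longlonglongrightarrow> x" and "\<And>n. b n \<in> S" "b \<longlonglongrightarrow> y"
    by (auto simp: closure_sequential)
  then show "x + y \<in> closure S"
    unfolding closure_sequential
    by (intro exI[of _ "\<lambda>n. a n + b n"] conjI allI tendsto_add subspace_add[OF S])
next
  fix t :: real and x assume "x \<in> closure S"
  then obtain a where "\<And>n. a n \<in> S" "a \<longlonglongrightarrow> x" by (auto simp: closure_sequential)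
  then show "t *\<^sub>R x \<in> closure S"
    unfolding closure_sequential
    by (intro exI[of _ "\<lambda>n. t *\<^sub>R a n"] conjI allI tendsto_scaleR tendsto_const subspace_scale[OF S])
qed

lemma invariant_closure_span:
  assumes iso: "isometric_action act" and inv: "\<And>j. j \<in> I \<Longrightarrow> invariant_set act (F j)"
  shows "invariant_set act (closure (span (\<Union>j\<in>I. F j)))"
proof (rule invariant_setI[OF isometric_imp_linear_action[OF iso]])
  fix g x assume x: "x \<in> closure (span (\<Union>j\<in>I. F j))"
  have "act g ` (\<Union>j\<in>I. F j) = (\<Union>j\<in>I. F j)"
    using inv by (auto simp: invariant_set_def image_UN)
  then have "act g ` span (\<Union>j\<in>I. F j) = span (\<Union>j\<in>I. F j)"
    using linear_span_image[OF isometric_action_linear[OF iso], of g "\<Union>j\<in>I. F j"] by simp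
  then have "act g ` closure (span (\<Union>j\<in>I. F j)) \<subseteq> closure (span (\<Union>j\<in>I. F j))"
    by (intro image_closure_subset isometric_action_continuous[OF iso]) (auto simp: closure_subset[THEN subsetD])
  then show "act g x \<in> closure (span (\<Union>j\<in>I. F j))" using x by blast
qed

theorem theorem3p2:
  fixes actE :: "'g::topological_group_add \<Rightarrow> 'e::banach \<Rightarrow> 'e"
    and actV :: "'g \<Rightarrow> 'v::euclidean_space \<Rightarrow> 'v"
    and E :: "nat \<Rightarrow> 'e set"
    and f :: "'e \<Rightarrow> real"
    and r \<rho> :: "nat \<Rightarrow> real"
  assumes compact_group: "compact (UNIV :: 'g set)"
    and action_E: "isometric_action actE"
    and action_V: "linear_action actV"
    and admissible_V: "admissible actV"
    and E_subspace: "\<And>j. subspace (E j)"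
    and E_invariant: "\<And>j. invariant_set actE (E j)"
    and E_iso_V: "\<And>j. action_iso actV actE (E j)"
    and E_direct: "direct_family E"
    and E_dense: "closure (span (\<Union>j. E j)) = UNIV"
    and f_cont: "continuous_on UNIV f"
    and f_inv: "invariant_fun actE f"
    and radii: "\<And>k. 0 < r k \<and> r k < \<rho> k"
    and A2: "\<And>k. (SUP u\<in>{u \<in> Y_space E k. norm u = \<rho> k}. ereal (f u)) \<le> 0"
    and A3: "(\<lambda>k. INF u\<in>{u \<in> Z_space E k. norm u = r k}. ereal (f u)) \<longlonglongrightarrow> \<infinity>"
    and A4: "\<And>c. 0 < c \<Longrightarrow> PS_condition actE f c"
  shows "\<exists>c :: nat \<Rightarrow> real. (\<forall>n. critical_value actE f (c n)) \<and> \<not> bounded (range c)"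
proof -
  have "\<forall>j. \<exists>\<phi> \<psi>. linear \<phi> \<and> homeomorphism UNIV (E j) \<phi> \<psi> \<and> equivariant_on UNIV actV actE \<phi>"
    using E_iso_V by (simp add: action_iso_def)
  then obtain \<phi> \<psi> where \<phi>: "\<And>j. linear (\<phi> j)" "\<And>j. homeomorphism UNIV (E j) (\<phi> j) (\<psi> j)"
    and "\<And>j. equivariant_on UNIV actV actE (\<phi> j)" by metis
  then have \<phi>_equiv: "\<phi> j (actV g v) = actE g (\<phi> j v)" for j g v by (simp add: equivariant_on_def)
  have \<phi>_cont: "continuous_on UNIV (\<phi> j)" and \<phi>_range: "range (\<phi> j) = E j" and \<psi>\<phi>: "\<psi> j (\<phi> j v) = v" for j v
    using \<phi>(2)[of j] by (auto simp: homeomorphism_def)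
  obtain C where C: "0 < C" "\<And>g v. norm (actV g v) \<le> C * norm v"
    using compact_group_action_bounded[OF action_V compact_group compact_sphere] by blast
  have inj: "x i = 0" if "block_sum \<phi> (Suc k) x = 0" "i < Suc k" for k x i
  proof -
    have "(\<Sum>j\<le>k. \<phi> j (x j)) = 0" using that(1) by (simp add: block_sum_def lessThan_Suc_atMost)
    then have "\<phi> i (x i) = 0"
      using E_direct that(2) \<phi>_range unfolding direct_family_def by (metis less_Suc_eq_le rangeI)
    then show ?thesis using \<psi>\<phi>[of i "x i"] \<psi>\<phi>[of i 0] linear_0[OF \<phi>(1)] by metis
  qed
  have span_E: "span (\<Union>i\<in>{..<n}. E i) = range (block_sum \<phi> n)" for n
    by (rule span_blocks[OF \<phi>(1) \<phi>_range])
  have dense: "\<exists>x. infdist (y - (\<Sum>i<k. \<phi> i (x i))) (Z_space E k) < e" if "0 < e" for y e k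
  proof -
    have "y \<in> closure (span (\<Union>j. E j))" using E_dense by simp
    then obtain w where w: "w \<in> span (\<Union>j. E j)" "dist w y < e" using \<open>0 < e\<close> closure_approachable by blast
    have "{..<k} \<union> {k..} = UNIV" by auto
    then have "(\<Union>j. E j) = (\<Union>j\<in>{..<k}. E j) \<union> (\<Union>j\<in>{k..}. E j)" by (metis UN_Un)
    then obtain a b where ab: "w = a + b" "a \<in> range (block_sum \<phi> k)" "b \<in> span (\<Union>j\<in>{k..}. E j)"
      using w(1) span_E[of k] by (auto simp: span_Un)
    obtain x where x: "a = block_sum \<phi> k x" using ab(2) by blast
    have "b \<in> Z_space E k" unfolding Z_space_def using ab(3) closure_subset by blast
    then have "infdist (y - a) (Z_space E k) \<le> dist (y - a) b" by (rule infdist_le)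
    also have "\<dots> = dist w y" using ab(1) by (simp add: dist_norm norm_minus_commute algebra_simps)
    finally have "infdist (y - block_sum \<phi> k x) (Z_space E k) < e" using w(2) x by simp
    then show ?thesis by (auto simp: block_sum_def)
  qed
  have above: "\<exists>m\<ge>a. critical_value actE f m" for a
  proof -
    define L where "L = max 0 (f 0)"
    \<comment> \<open>Above \<open>L\<close> the deformations leave both the sphere of radius \<open>\<rho> k\<close>, by (A2), and the origin fixed.\<close>
    define c where "c = max a L + 1"
    have c: "L < c" "0 < c" "a \<le> c" by (auto simp: L_def c_def)
    have "\<forall>\<^sub>F k in sequentially. ereal c < (INF u\<in>{u \<in> Z_space E k. norm u = r k}. ereal (f u))"
      using A3 by (simp add: tendsto_PInfty)
    from eventually_happens'[OF sequentially_bot eventually_conj[OF eventually_ge_at_top[of 1] this]]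
    obtain k where k: "1 \<le> k" "ereal c < (INF u\<in>{u \<in> Z_space E k. norm u = r k}. ereal (f u))"
      by blast
    let ?Z = "Z_space E k" and ?B = "block_ball \<phi> (Suc k) (\<rho> k)"
    obtain T where T: "\<And>i. i < k \<Longrightarrow> continuous_on UNIV (\<lambda>y. T y i)"
      "\<And>g y i. i < k \<Longrightarrow> T (actE g y) i = actV g (T y i)"
      "\<And>y. (\<And>i. i < k \<Longrightarrow> T y i = 0) \<Longrightarrow> y \<in> ?Z"
    proof (rule equivariant_map_zeros_in_closed_subspace[of actE actV C \<phi>, OF action_E action_V C \<phi>(1) \<phi>_cont \<phi>_equiv])
      show "subspace ?Z" unfolding Z_space_def by (intro subspace_closure subspace_span)
      show "closed ?Z" by (simp add: Z_space_def)
      show "invariant_set actE ?Z"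
        unfolding Z_space_def by (rule invariant_closure_span[OF action_E E_invariant])
    qed (use dense in auto)
    obtain c' where c': "0 < c'" "\<And>x i. i < Suc k \<Longrightarrow> norm (x i) \<le> c' * norm (block_sum \<phi> (Suc k) x)"
    proof (rule block_sum_bounded_below[of \<phi> "Suc k", OF \<phi>(1) \<phi>_cont])
      show "x i = 0" if "block_sum \<phi> (Suc k) x = 0" "i < Suc k" for x i using that by (rule inj)
    qed (rule that)
    have "\<exists>m\<ge>c. critical_value actE f m"
    proof (rule minimax_critical_value[OF action_E f_cont f_inv, where B = ?B
          and A = "{y \<in> ?B. y = 0 \<or> norm y = \<rho> k}" and L = L])
      show "compact ?B" by (rule compact_block_ball[of \<phi>, OF \<phi>_cont c'])
      have "block_sum \<phi> (Suc k) (\<lambda>_. 0) = 0" by (simp add: block_sum_def linear_0[OF \<phi>(1)])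
      then have "0 \<in> ?B" using radii[of k] unfolding block_ball_def
        by (metis (mono_tags, lifting) less_eq_real_def less_trans mem_Collect_eq norm_zero rangeI)
      then show "?B \<noteq> {}" by blast
      show "invariant_set actE ?B" by (rule invariant_block_ball[of actE \<phi> actV, OF action_E \<phi>_equiv])
      show "f y \<le> L" if "y \<in> {y \<in> ?B. y = 0 \<or> norm y = \<rho> k}" for y
      proof (cases "y = 0")
        case False
        have "y \<in> Y_space E k"
          using that span_E[of "Suc k"]
          by (auto simp: Y_space_def block_ball_def lessThan_Suc_atMost atMost_atLeast0)
        then have "ereal (f y) \<le> (SUP u\<in>{u \<in> Y_space E k. norm u = \<rho> k}. ereal (f u))"
          using that False by (intro SUP_upper) auto
        from order_trans[OF this A2[of k]] show ?thesis by (simp add: L_def max.coboundedI1)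
      qed (simp add: L_def)
      show "\<exists>x\<in>?B. c \<le> f (\<gamma> x)"
        if \<gamma>: "\<gamma> \<in> equivariant_maps_rel actE ?B {y \<in> ?B. y = 0 \<or> norm y = \<rho> k}" for \<gamma>
      proof -
        obtain y where y: "y \<in> ?B" "\<gamma> y \<in> ?Z" "norm (\<gamma> y) = r k"
        proof (rule admissible_linking[where k = k and \<phi> = \<phi> and T = T and Z = ?Z,
              OF action_E action_V admissible_V \<phi>(1) \<phi>_cont \<phi>_equiv c'(1) _ k(1) _ _ _ _ _ \<gamma>])
          show "norm (x i) \<le> c' * norm (block_sum \<phi> (Suc k) x)" if "i < Suc k" for x i
            using that by (rule c'(2))
          show "y \<in> ?Z" if "\<And>i. i < k \<Longrightarrow> T y i = 0" for y using that by (rule T(3))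
        qed (use radii[of k] T(1,2) that in auto)
        have "(INF u\<in>{u \<in> ?Z. norm u = r k}. ereal (f u)) \<le> ereal (f (\<gamma> y))"
          using y by (intro INF_lower) auto
        then have "ereal c < ereal (f (\<gamma> y))" by (rule less_le_trans[OF k(2)])
        then show ?thesis using y(1) by (intro bexI[of _ y]) auto
      qed
      show "PS_condition actE f m" if "c \<le> m" for m using A4 c(2) that by simp
    qed (use c in auto)
    then show ?thesis using c(3) by (meson order_trans)
  qed
  then have "\<forall>n. \<exists>m. real n \<le> m \<and> critical_value actE f m" by blast
  then obtain c :: "nat \<Rightarrow> real" where c: "\<And>n. real n \<le> c n" "\<And>n. critical_value actE f (c n)"
    by metis
  have "\<not> bounded (range c)"
  proof
    assume "bounded (range c)"
    then obtain M where M: "\<And>n. \<bar>c n\<bar> \<le> M" by (auto simp: bounded_real)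
    obtain n where "M < real n" using reals_Archimedean2 by blast
    then show False using c(1)[of n] M[of n] by linarith
  qed
  then show ?thesis using c(2) by blast
qed

end
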